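(* Let $\mathcal{E}$ be an $E$-valued differential operator on a smooth fiber bundle $Y\to X$ such that the homology $H_1(\delta)$ is finitely generated (in the sense of the context), with associated one-exact complex $$0\leftarrow \operatorname{Im}\delta\xleftarrow{\ \delta\ }\mathcal{S}_\infty[E;Y]_1\xleftarrow{\ \delta_0\ }\mathcal{P}_\infty[E;Y;E_0]_2\xleftarrow{\ \delta_0\ }\mathcal{P}_\infty[E;Y;E_0]_3 ,$$ whose homology is denoted $H_*(\delta_0)$. First-stage Noether identities can be identified to nontrivial elements of the homology $H_2(\delta_0)$ if and only if any $\delta$-cycle $\Phi\in\mathcal{S}_\infty[E;Y]_2$ is a $\delta_0$-boundary.
   Context: Jets: $J^rY$ is the $r$-th order jet manifold of sections of $Y\to X$, with local coordinates $(x^\lambda,y^i_\Lambda)$, $0\le|\Lambda|\le r$, $\Lambda=(\lambda_1\dots\lambda_k)$ a symmetric multi-index; $\mathcal{O}_\infty Y$ is the direct limit of the rings $C^\infty(J^rY)$ under pull-back. Graded functions: for a vector bundle $E\to X$, $\mathcal{S}_\infty[E;Y]$ is the direct limit of the exterior algebras over $C^\infty(J^rY)$ of the modules of sections of the duals of $J^rY\times_X J^rE\to J^rY$. It is locally generated over $\mathcal{O}_\infty Y$ by odd elements $c^a_\Lambda$, the jets of a local fiber basis $\{c^a\}$ for $E^*$. For a vector bundle $E_0\to X$, $\mathcal{P}_\infty[E;Y;E_0]$ is the subring of $\mathcal{S}_\infty[E;Y\times_X E_0]$ of graded functions polynomial in the fiber coordinates of $Y\times_X E_0\to Y$ (and their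 jets); it has local bases $\{y^i_\Lambda,c^a_\Lambda,c^r_\Lambda\}$ with $c^r_\Lambda$ even. Antifield numbers: $0$ on $\mathcal{O}_\infty Y$, $\mathrm{Ant}[c^a_\Lambda]=1$, $\mathrm{Ant}[c^r_\Lambda]=2$, additive on products; a subscript $k$ denotes the part of antifield number $k$. Total derivatives are $d_\lambda=\partial_\lambda+\sum_{0\le|\Lambda|} s^A_{\lambda+\Lambda}\partial^\Lambda_A$, with $s^A_\Lambda$ running over all local basis elements, and $d_\Lambda=d_{\lambda_1}\circ\cdots\circ d_{\lambda_k}$. Operator and differentials: an $E$-valued differential operator $\mathcal{E}$ on $Y$ is a bundle morphism $J^rY\to E$ over $X$, locally given by functions $\mathcal{E}^a\in\mathcal{O}_\infty Y$; $\operatorname{Ker}\mathcal{E}$ is its kernel. Derivations act on the right: $\delta(ff')=(-1)^{[f']}\delta(f)f'+f\delta(f')$, $[f']$ the Grassmann parity. The Koszul--Tate differential $\delta$ vanishes on $\mathcal{O}_\infty Y$ and satisfies $\delta(c^a_\Lambda)=d_\Lambda\mathcal{E}^a$. $H_1(\delta)$ is the homology at $\mathcal{S}_\infty[E;Y]_1$ of $0\leftarrow\operatorname{Im}\delta\leftarrow\mathcal{S}_\infty[E;Y]_1\leftarrow\mathcal{S}_\infty[E;Y]_2$ with boundary operator $\delta$. $H_1(\delta)$ is finitely generated if there are elements $\Delta\in H_1(\delta)$ (called Noether operators) making up a projective $C^\infty(X)$-module of finite rank, isomorphic to the module of sections of a vector bundle $E_0\to X$, with local bases $\{\Delta^r\}$,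 $\Delta^r=\sum_{0\le|\Lambda|}\Delta_a^{\Lambda r}c^a_\Lambda$, $\Delta_a^{\Lambda r}\in\mathcal{O}_\infty Y$, such that every $\Phi\in H_1(\delta)$ factorizes as $\Phi=\sum_{0\le|\Xi|}G_r^\Xi d_\Xi\Delta^r$ with $G_r^\Xi\in\mathcal{O}_\infty Y$. The extended Koszul--Tate differential $\delta_0$ is the nilpotent right derivation of $\mathcal{P}_\infty[E;Y;E_0]$ that vanishes on $\mathcal{O}_\infty Y$, with $\delta_0(c^a_\Lambda)=d_\Lambda\mathcal{E}^a$ and $\delta_0(c^r_\Lambda)=d_\Lambda\Delta^r$. One-exact means that the homology in degrees $0$ and $1$ is trivial. First-stage Noether identities: a generic two-chain is $\Phi=G+H$ with $G=\sum_{0\le|\Lambda|}G_r^\Lambda c^r_\Lambda$ and $H=\sum_{0\le|\Lambda|,|\Sigma|}H_{ab}^{\Lambda\Sigma}c^a_\Lambda c^b_\Sigma$, all coefficients in $\mathcal{O}_\infty Y$. Its cycle condition $\delta_0\Phi=0$ reads $\sum_{0\le|\Lambda|}G_r^\Lambda d_\Lambda\Delta^r+\delta H=0$ and is regarded as a reduction condition on the Noether operators $\Delta^r$. The reduction condition is trivial either if the two-cycle $\Phi$ is a boundary or if its summand $G$ vanishes on $\operatorname{Ker}\mathcal{E}$. Nontrivial reduction conditions are called first-stage Noether identities.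
   Formalization: "G vanishes on Ker E" is read as "G is δ-exact" (all operators); the version with pointwise vanishing on Ker E is stated only for operators where pointwise vanishing implies δ-exactness, since it fails e.g. for E=(u²,uv,u_t,v_t). *)

theory Defs
  imports "HOL-Analysis.Analysis" "HOL-Library.Multiset" "HOL-Library.Function_Algebras"
begin

section \<open>Smooth functions on coordinate spaces\<close>

text \<open>
  Jet manifolds have coordinates indexed by multi-indices, so a coordinate space is taken to be
  \<open>\<real>\<^sup>I\<close> for a finite index set \<open>I\<close>: the functions vanishing outside \<open>I\<close>, topologised as a subspace
  of the product.  Dimension and rank \<open>0\<close> are thereby allowed.
\<close>

definition coord_space :: "'i set \<Rightarrow> ('i \<Rightarrow> real) set" where
  "coord_space I = {q. \<forall>i. i \<notin> I \<longrightarrow> q i = 0}"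

definition restr :: "'i set \<Rightarrow> ('i \<Rightarrow> real) \<Rightarrow> ('i \<Rightarrow> real)" where
  "restr I q = (\<lambda>i. if i \<in> I then q i else 0)"

definition partial :: "'i \<Rightarrow> (('i \<Rightarrow> real) \<Rightarrow> real) \<Rightarrow> ('i \<Rightarrow> real) \<Rightarrow> real" where
  "partial i f q = deriv (\<lambda>t. f (q(i := t))) (q i)"

definition partials :: "'i list \<Rightarrow> (('i \<Rightarrow> real) \<Rightarrow> real) \<Rightarrow> ('i \<Rightarrow> real) \<Rightarrow> real" where
  "partials is f = foldr partial is f"

text \<open>\<open>C\<^sup>\<infinity>\<close>: all iterated partial derivatives exist and are continuous.  Meant for \<open>U\<close> open in
  \<open>coord_space I\<close>, where the values at points of \<open>U\<close> do not depend on \<open>f\<close> off \<open>U\<close>.\<close>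

definition smooth_on :: "'i set \<Rightarrow> ('i \<Rightarrow> real) set \<Rightarrow> (('i \<Rightarrow> real) \<Rightarrow> real) \<Rightarrow> bool" where
  "smooth_on I U f \<longleftrightarrow>
     (\<forall>is \<in> lists I. continuous_on U (partials is f) \<and>
        (\<forall>i \<in> I. \<forall>q \<in> U. (\<lambda>t. partials is f (q(i := t))) field_differentiable at (q i)))"


section \<open>Manifolds and bundles\<close>

record 'x mfd =
  mdim :: nat
  atlas :: "('x set \<times> ('x \<Rightarrow> nat \<Rightarrow> real)) set"

definition is_manifold :: "('x::{t2_space,second_countable_topology}) mfd \<Rightarrow> bool" where
  "is_manifold M \<longleftrightarrow>
     (\<Union>(A, \<phi>) \<in> atlas M. A) = UNIV \<and>
     (\<forall>(A, \<phi>) \<in> atlas M. open A \<and> \<phi> ` A \<subseteq> coord_space {..<mdim M} \<and>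
        openin (top_of_set (coord_space {..<mdim M})) (\<phi> ` A) \<and>
        inj_on \<phi> A \<and> homeomorphism A (\<phi> ` A) \<phi> (inv_into A \<phi>)) \<and>
     (\<forall>(A, \<phi>) \<in> atlas M. \<forall>(A', \<phi>') \<in> atlas M. \<forall>i < mdim M.
        smooth_on {..<mdim M} (\<phi> ` (A \<inter> A')) (\<lambda>p. \<phi>' (inv_into A \<phi> p) i))"

definition smooth_fun :: "'x mfd \<Rightarrow> 'x set \<Rightarrow> ('x \<Rightarrow> real) \<Rightarrow> bool" where
  "smooth_fun M W f \<longleftrightarrow>
     (\<forall>(A, \<phi>) \<in> atlas M. smooth_on {..<mdim M} (\<phi> ` (A \<inter> W)) (\<lambda>p. f (inv_into A \<phi> p)))"

definition smooth_map ::
    "('x::topological_space) mfd \<Rightarrow> ('v::topological_space) mfd \<Rightarrow> 'x set \<Rightarrow> ('x \<Rightarrow> 'v) \<Rightarrow> bool" where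
  "smooth_map M N W g \<longleftrightarrow>
     continuous_on W g \<and>
     (\<forall>(A, \<phi>) \<in> atlas M. \<forall>(B, \<eta>) \<in> atlas N. \<forall>i < mdim N.
        smooth_on {..<mdim M} (\<phi> ` (A \<inter> W \<inter> g -` B)) (\<lambda>p. \<eta> (g (inv_into A \<phi> p)) i))"

definition prod_mfd :: "'x mfd \<Rightarrow> 'v mfd \<Rightarrow> ('x \<times> 'v) mfd" where
  "prod_mfd M N =
     \<lparr> mdim = mdim M + mdim N,
       atlas = {(A \<times> B, \<lambda>(x, v) i. if i < mdim M then \<phi> x i else \<eta> v (i - mdim M)) | A \<phi> B \<eta>.
                  (A, \<phi>) \<in> atlas M \<and> (B, \<eta>) \<in> atlas N} \<rparr>"

text \<open>A smooth fibre bundle \<open>Y \<rightarrow> X\<close> with typical fibre \<open>V\<close>, given by a smooth bundle atlas; the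
  manifold structure of the total space is the one the trivialisations \<open>proj\<^sup>-\<^sup>1(U) \<cong> U \<times> V\<close> induce.\<close>

record ('x, 'y, 'v) fbundle =
  base :: "'x mfd"
  tfib :: "'v mfd"
  proj :: "'y \<Rightarrow> 'x"
  trivs :: "('x set \<times> ('y \<Rightarrow> 'v)) set"

definition is_fibre_bundle ::
    "('x::{t2_space,second_countable_topology}, 'y, 'v::{t2_space,second_countable_topology}) fbundle
       \<Rightarrow> bool" where
  "is_fibre_bundle Y \<longleftrightarrow>
     is_manifold (base Y) \<and> is_manifold (tfib Y) \<and>
     (\<Union>(U, \<psi>) \<in> trivs Y. U) = UNIV \<and>
     (\<forall>(U, \<psi>) \<in> trivs Y. open U \<and>
        bij_betw (\<lambda>y. (proj Y y, \<psi> y)) (proj Y -` U) (U \<times> UNIV)) \<and>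
     (\<forall>(U, \<psi>) \<in> trivs Y. \<forall>(U', \<psi>') \<in> trivs Y.
        smooth_map (prod_mfd (base Y) (tfib Y)) (tfib Y) ((U \<inter> U') \<times> UNIV)
          (\<lambda>xv. \<psi>' (inv_into (proj Y -` U) (\<lambda>y. (proj Y y, \<psi> y)) xv)))"

text \<open>A vector bundle is a family of subspaces of an ambient real vector space without topology (no
  restriction: take the direct sum of all fibres), with smoothly related local frames.\<close>

record ('x, 'f) vbundle =
  vrank :: nat
  vfib :: "'x \<Rightarrow> 'f set"
  frames :: "('x set \<times> (nat \<Rightarrow> 'x \<Rightarrow> 'f)) set"

definition is_vector_bundle ::
    "('x::topological_space) mfd \<Rightarrow> ('x, 'f::real_vector) vbundle \<Rightarrow> bool" where
  "is_vector_bundle X E \<longleftrightarrow>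
     (\<Union>(U, b) \<in> frames E. U) = UNIV \<and>
     (\<forall>(U, b) \<in> frames E. open U \<and>
        (\<forall>x \<in> U. inj_on (\<lambda>a. b a x) {..<vrank E} \<and> independent ((\<lambda>a. b a x) ` {..<vrank E}) \<and>
                 span ((\<lambda>a. b a x) ` {..<vrank E}) = vfib E x)) \<and>
     (\<forall>(U, b) \<in> frames E. \<forall>(U', b') \<in> frames E. \<forall>a < vrank E.
        \<exists>g. (\<forall>c < vrank E. smooth_fun X (U \<inter> U') (g c)) \<and>
            (\<forall>x \<in> U \<inter> U'. b' a x = (\<Sum>c<vrank E. g c x *\<^sub>R b c x)))"

definition fcoord :: "('x, 'f::real_vector) vbundle \<Rightarrow> (nat \<Rightarrow> 'x \<Rightarrow> 'f) \<Rightarrow> 'x \<Rightarrow> 'f \<Rightarrow> nat \<Rightarrow> real" where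
  "fcoord E b x v a = representation ((\<lambda>c. b c x) ` {..<vrank E}) v (b a x)"

definition local_section ::
    "('x::topological_space, 'y, 'v::topological_space) fbundle \<Rightarrow> 'x \<Rightarrow> ('x \<Rightarrow> 'y) \<Rightarrow> bool" where
  "local_section Y x s \<longleftrightarrow>
     (\<exists>N. open N \<and> x \<in> N \<and> (\<forall>x' \<in> N. proj Y (s x') = x') \<and>
        (\<forall>(U, \<psi>) \<in> trivs Y. smooth_map (base Y) (tfib Y) (N \<inter> U) (\<psi> \<circ> s)))"

definition local_vsection ::
    "('x::topological_space) mfd \<Rightarrow> ('x, 'f::real_vector) vbundle \<Rightarrow> 'x \<Rightarrow> ('x \<Rightarrow> 'f) \<Rightarrow> bool" where
  "local_vsection X E x e \<longleftrightarrow>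
     (\<exists>N. open N \<and> x \<in> N \<and> (\<forall>x' \<in> N. e x' \<in> vfib E x') \<and>
        (\<forall>(U, b) \<in> frames E. \<forall>a < vrank E.
           smooth_fun X (N \<inter> U) (\<lambda>x'. fcoord E b x' (e x') a)))"


section \<open>Adapted charts and jet coordinates\<close>

type_synonym multi_index = "nat multiset"

definition multi_indices :: "nat \<Rightarrow> nat \<Rightarrow> multi_index set" where
  "multi_indices n r = {\<Lambda>. set_mset \<Lambda> \<subseteq> {..<n} \<and> size \<Lambda> \<le> r}"

text \<open>Coordinate labels: \<open>Base \<lambda>\<close> for \<open>x\<^sup>\<lambda>\<close> and \<open>Fib i \<Lambda>\<close> for \<open>y\<^sup>i\<^sub>\<Lambda>\<close>.  A pair \<open>(a, \<Lambda>)\<close> labels the jet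
  coordinate of a vector bundle, i.e. \<open>c\<^sup>a\<^sub>\<Lambda>\<close> for \<open>E\<close> and \<open>c\<^sup>r\<^sub>\<Lambda>\<close> for \<open>E\<^sub>0\<close>.\<close>

datatype jvar = Base nat | Fib nat multi_index

type_synonym jet = "jvar \<Rightarrow> real"
type_synonym vjet = "nat \<times> multi_index \<Rightarrow> real"

definition jvars :: "('x, 'y, 'v) fbundle \<Rightarrow> nat \<Rightarrow> jvar set" where
  "jvars Y r = Base ` {..<mdim (base Y)} \<union>
     {Fib i \<Lambda> | i \<Lambda>. i < mdim (tfib Y) \<and> \<Lambda> \<in> multi_indices (mdim (base Y)) r}"

text \<open>Joint local data: a chart of \<open>X\<close>, a trivialisation of \<open>Y\<close>, a chart of the typical fibre and
  frames of \<open>E\<close> and \<open>E\<^sub>0\<close>.\<close>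

record ('x, 'y, 'v, 'f, 'g) achart =
  bch :: "'x set \<times> ('x \<Rightarrow> nat \<Rightarrow> real)"
  triv :: "'x set \<times> ('y \<Rightarrow> 'v)"
  fch :: "'v set \<times> ('v \<Rightarrow> nat \<Rightarrow> real)"
  frE :: "'x set \<times> (nat \<Rightarrow> 'x \<Rightarrow> 'f)"
  frE0 :: "'x set \<times> (nat \<Rightarrow> 'x \<Rightarrow> 'g)"

definition acharts ::
    "('x, 'y, 'v) fbundle \<Rightarrow> ('x, 'f) vbundle \<Rightarrow> ('x, 'g) vbundle \<Rightarrow> ('x, 'y, 'v, 'f, 'g) achart set" where
  "acharts Y E E0 = {\<kappa>. bch \<kappa> \<in> atlas (base Y) \<and> triv \<kappa> \<in> trivs Y \<and> fch \<kappa> \<in> atlas (tfib Y) \<and>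
                        frE \<kappa> \<in> frames E \<and> frE0 \<kappa> \<in> frames E0}"

definition xdom :: "('x, 'y, 'v, 'f, 'g) achart \<Rightarrow> 'x set" where
  "xdom \<kappa> = fst (bch \<kappa>) \<inter> fst (triv \<kappa>) \<inter> fst (frE \<kappa>) \<inter> fst (frE0 \<kappa>)"

definition xinv :: "('x, 'y, 'v, 'f, 'g) achart \<Rightarrow> (nat \<Rightarrow> real) \<Rightarrow> 'x" where
  "xinv \<kappa> = inv_into (fst (bch \<kappa>)) (snd (bch \<kappa>))"

text \<open>The part of the infinite jet space covered by \<open>\<kappa>\<close>, in coordinates.\<close>

definition jdom :: "('x, 'y, 'v, 'f, 'g) achart \<Rightarrow> jet set" where
  "jdom \<kappa> = {q. (\<lambda>i. q (Base i)) \<in> snd (bch \<kappa>) ` xdom \<kappa> \<and>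
                (\<lambda>i. q (Fib i {#})) \<in> snd (fch \<kappa>) ` fst (fch \<kappa>)}"

definition covers :: "('x, 'y, 'v, 'f, 'g) achart \<Rightarrow> 'x \<Rightarrow> ('x \<Rightarrow> 'y) \<Rightarrow> bool" where
  "covers \<kappa> x s \<longleftrightarrow> x \<in> xdom \<kappa> \<and> snd (triv \<kappa>) (s x) \<in> fst (fch \<kappa>)"

definition dmulti :: "multi_index \<Rightarrow> ((nat \<Rightarrow> real) \<Rightarrow> real) \<Rightarrow> (nat \<Rightarrow> real) \<Rightarrow> real" where
  "dmulti \<Lambda> f = partials (sorted_list_of_multiset \<Lambda>) f"

text \<open>Coordinates of the infinite jets at \<open>x\<close> of local sections of \<open>Y\<close>, \<open>E\<close> and \<open>E\<^sub>0\<close>.\<close>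

fun jet_of :: "('x, 'y, 'v, 'f, 'g) achart \<Rightarrow> 'x \<Rightarrow> ('x \<Rightarrow> 'y) \<Rightarrow> jet" where
  "jet_of \<kappa> x s (Base i) = snd (bch \<kappa>) x i"
| "jet_of \<kappa> x s (Fib i \<Lambda>) =
     dmulti \<Lambda> (\<lambda>p. snd (fch \<kappa>) (snd (triv \<kappa>) (s (xinv \<kappa> p))) i) (snd (bch \<kappa>) x)"

definition vjet_E ::
    "('x, 'f::real_vector) vbundle \<Rightarrow> ('x, 'y, 'v, 'f, 'g) achart \<Rightarrow> 'x \<Rightarrow> ('x \<Rightarrow> 'f) \<Rightarrow> vjet" where
  "vjet_E E \<kappa> x e = (\<lambda>(a, \<Lambda>).
     dmulti \<Lambda> (\<lambda>p. fcoord E (snd (frE \<kappa>)) (xinv \<kappa> p) (e (xinv \<kappa> p)) a) (snd (bch \<kappa>) x))"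

definition vjet_E0 ::
    "('x, 'g::real_vector) vbundle \<Rightarrow> ('x, 'y, 'v, 'f, 'g) achart \<Rightarrow> 'x \<Rightarrow> ('x \<Rightarrow> 'g) \<Rightarrow> vjet" where
  "vjet_E0 E0 \<kappa> x w = (\<lambda>(r, \<Lambda>).
     dmulti \<Lambda> (\<lambda>p. fcoord E0 (snd (frE0 \<kappa>)) (xinv \<kappa> p) (w (xinv \<kappa> p)) r) (snd (bch \<kappa>) x))"


section \<open>Local graded functions\<close>

text \<open>
  Over one adapted chart a polynomial in the odd \<open>c\<^sup>a\<^sub>\<Lambda>\<close> and even \<open>c\<^sup>r\<^sub>\<Lambda>\<close> with coefficients depending on
  jets of \<open>Y\<close> is a field of multilinear forms: the value at a jet \<open>q\<close> of \<open>Y\<close>, a list \<open>es\<close> of jets of \<open>E\<close>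
  (in which it is alternating) and a list \<open>ws\<close> of jets of \<open>E\<^sub>0\<close> (in which it is symmetric).  The
  product is the shuffle product, so \<open>c\<^sup>a c\<^sup>b (e\<^sub>1, e\<^sub>2) = c\<^sup>a(e\<^sub>1) c\<^sup>b(e\<^sub>2) - c\<^sup>a(e\<^sub>2) c\<^sup>b(e\<^sub>1)\<close>.  The sum is
  pointwise.
\<close>

type_synonym gfun = "jet \<Rightarrow> vjet list \<Rightarrow> vjet list \<Rightarrow> real"

definition shuffle_sgn :: "nat set \<Rightarrow> nat \<Rightarrow> real" where
  "shuffle_sgn A l = (-1) ^ card {(i, j). i \<in> A \<and> j \<in> {..<l} - A \<and> j < i}"

definition gmul :: "gfun \<Rightarrow> gfun \<Rightarrow> gfun" (infixl "\<odot>" 70) where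
  "f \<odot> g = (\<lambda>q es ws.
     \<Sum>A \<in> Pow {..<length es}. \<Sum>B \<in> Pow {..<length ws}.
       shuffle_sgn A (length es) *
       f q (nths es A) (nths ws B) * g q (nths es (- A)) (nths ws (- B)))"

text \<open>The linear map that is \<open>f \<mapsto> (-1)\<^bsup>[f]\<^esup> f\<close> on elements of definite Grassmann parity \<open>[f]\<close>.\<close>

definition ginv :: "gfun \<Rightarrow> gfun" where
  "ginv f = (\<lambda>q es ws. (-1) ^ length es * f q es ws)"

definition has_ant :: "nat \<Rightarrow> gfun \<Rightarrow> bool" where
  "has_ant k f \<longleftrightarrow> (\<forall>q es ws. f q es ws \<noteq> 0 \<longrightarrow> length es + 2 * length ws = k)"

text \<open>Functions on the \<open>r\<close>-th order jets of \<open>Y\<close>, smooth in the coordinates, pulled back to infinite jets.\<close>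

definition Oloc :: "('x, 'y, 'v) fbundle \<Rightarrow> ('x, 'y, 'v, 'f, 'g) achart \<Rightarrow> nat \<Rightarrow> gfun set" where
  "Oloc Y \<kappa> r = {f. \<exists>F. smooth_on (jvars Y r) (jdom \<kappa> \<inter> coord_space (jvars Y r)) F \<and>
     f = (\<lambda>q es ws. if q \<in> jdom \<kappa> \<and> es = [] \<and> ws = [] then F (restr (jvars Y r) q) else 0)}"

definition c_odd :: "('x, 'y, 'v, 'f, 'g) achart \<Rightarrow> nat \<Rightarrow> multi_index \<Rightarrow> gfun" where
  "c_odd \<kappa> a \<Lambda> = (\<lambda>q es ws.
     if q \<in> jdom \<kappa> \<and> length es = 1 \<and> ws = [] then hd es (a, \<Lambda>) else 0)"

definition c_even :: "('x, 'y, 'v, 'f, 'g) achart \<Rightarrow> nat \<Rightarrow> multi_index \<Rightarrow> gfun" where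
  "c_even \<kappa> i \<Lambda> = (\<lambda>q es ws.
     if q \<in> jdom \<kappa> \<and> es = [] \<and> length ws = 1 then hd ws (i, \<Lambda>) else 0)"

inductive_set generated :: "gfun set \<Rightarrow> gfun set" for B where
  gen: "f \<in> B \<Longrightarrow> f \<in> generated B"
| add: "f \<in> generated B \<Longrightarrow> g \<in> generated B \<Longrightarrow> f + g \<in> generated B"
| mul: "f \<in> generated B \<Longrightarrow> g \<in> generated B \<Longrightarrow> f \<odot> g \<in> generated B"

definition Sloc ::
    "('x, 'y, 'v) fbundle \<Rightarrow> ('x, 'f) vbundle \<Rightarrow> ('x, 'y, 'v, 'f, 'g) achart \<Rightarrow> nat \<Rightarrow> gfun set" where
  "Sloc Y E \<kappa> r = generated (Oloc Y \<kappa> r \<union>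
     {c_odd \<kappa> a \<Lambda> | a \<Lambda>. a < vrank E \<and> \<Lambda> \<in> multi_indices (mdim (base Y)) r})"

definition Ploc ::
    "('x, 'y, 'v) fbundle \<Rightarrow> ('x, 'f) vbundle \<Rightarrow> ('x, 'g) vbundle \<Rightarrow> ('x, 'y, 'v, 'f, 'g) achart \<Rightarrow> nat
       \<Rightarrow> gfun set" where
  "Ploc Y E E0 \<kappa> r = generated (Oloc Y \<kappa> r \<union>
     {c_odd \<kappa> a \<Lambda> | a \<Lambda>. a < vrank E \<and> \<Lambda> \<in> multi_indices (mdim (base Y)) r} \<union>
     {c_even \<kappa> i \<Lambda> | i \<Lambda>. i < vrank E0 \<and> \<Lambda> \<in> multi_indices (mdim (base Y)) r})"

text \<open>
  \<open>d\<^sub>\<lambda> = \<partial>\<^sub>\<lambda> + \<Sum> y\<^sup>i\<^bsub>\<lambda>+\<Lambda>\<^esub> \<partial>\<^sub>i\<^sup>\<Lambda> + \<Sum> c\<^sup>a\<^bsub>\<lambda>+\<Lambda>\<^esub> \<partial>\<^sub>a\<^sup>\<Lambda> + \<Sum> c\<^sup>r\<^bsub>\<lambda>+\<Lambda>\<^esub> \<partial>\<^sub>r\<^sup>\<Lambda>\<close>.  On multilinear forms the last two sums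
  replace \<open>c\<^sub>\<Lambda>\<close> by \<open>c\<^bsub>\<lambda>+\<Lambda>\<^esub>\<close> in one factor at a time, which is a shift in one argument.  The sum over
  \<open>(i, \<Lambda>)\<close> is restricted to nonzero terms; these are finitely many on functions of finite jet order.
\<close>

definition shift :: "nat \<Rightarrow> vjet \<Rightarrow> vjet" where
  "shift l e = (\<lambda>(a, \<Lambda>). e (a, add_mset l \<Lambda>))"

definition total_deriv ::
    "('x, 'y, 'v) fbundle \<Rightarrow> ('x, 'y, 'v, 'f, 'g) achart \<Rightarrow> nat \<Rightarrow> gfun \<Rightarrow> gfun" where
  "total_deriv Y \<kappa> l f = (\<lambda>q es ws.
     if q \<in> jdom \<kappa> then
       partial (Base l) (\<lambda>q'. f q' es ws) q +
       (\<Sum>(i, \<Lambda>) \<in> {(i, \<Lambda>). i < mdim (tfib Y) \<and> set_mset \<Lambda> \<subseteq> {..<mdim (base Y)} \<and>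
                           partial (Fib i \<Lambda>) (\<lambda>q'. f q' es ws) q \<noteq> 0}.
          q (Fib i (add_mset l \<Lambda>)) * partial (Fib i \<Lambda>) (\<lambda>q'. f q' es ws) q) +
       (\<Sum>j<length es. f q (es[j := shift l (es ! j)]) ws) +
       (\<Sum>j<length ws. f q es (ws[j := shift l (ws ! j)]))
     else 0)"

definition total_derivs ::
    "('x, 'y, 'v) fbundle \<Rightarrow> ('x, 'y, 'v, 'f, 'g) achart \<Rightarrow> multi_index \<Rightarrow> gfun \<Rightarrow> gfun" where
  "total_derivs Y \<kappa> \<Lambda> f = foldr (total_deriv Y \<kappa>) (sorted_list_of_multiset \<Lambda>) f"


section \<open>Global graded functions\<close>

text \<open>
  A global graded function is the family of its expressions in all adapted charts.  Expressions in
  two charts describe the same object iff they agree on jets of sections of \<open>Y\<close>, \<open>E\<close> and \<open>E\<^sub>0\<close>.  The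
  jet order is bounded uniformly over all charts: an element of the direct limit comes from some
  finite jet order.
\<close>

type_synonym ('x, 'y, 'v, 'f, 'g) gfield = "('x, 'y, 'v, 'f, 'g) achart \<Rightarrow> gfun"

definition compatible ::
    "('x::topological_space, 'y, 'v::topological_space) fbundle \<Rightarrow> ('x, 'f::real_vector) vbundle
       \<Rightarrow> ('x, 'g::real_vector) vbundle \<Rightarrow> ('x, 'y, 'v, 'f, 'g) gfield \<Rightarrow> bool" where
  "compatible Y E E0 \<Phi> \<longleftrightarrow>
     (\<forall>\<kappa> \<in> acharts Y E E0. \<forall>\<kappa>' \<in> acharts Y E E0. \<forall>x s es ws.
        covers \<kappa> x s \<and> covers \<kappa>' x s \<and> local_section Y x s \<and>
        (\<forall>e \<in> set es. local_vsection (base Y) E x e) \<and>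
        (\<forall>w \<in> set ws. local_vsection (base Y) E0 x w) \<longrightarrow>
        \<Phi> \<kappa> (jet_of \<kappa> x s) (map (vjet_E E \<kappa> x) es) (map (vjet_E0 E0 \<kappa> x) ws) =
        \<Phi> \<kappa>' (jet_of \<kappa>' x s) (map (vjet_E E \<kappa>' x) es) (map (vjet_E0 E0 \<kappa>' x) ws))"

text \<open>\<open>S\<^sub>\<infinity>[E;Y]\<close>, as a subring of the next one.\<close>

definition S_inf ::
    "('x::topological_space, 'y, 'v::topological_space) fbundle \<Rightarrow> ('x, 'f::real_vector) vbundle
       \<Rightarrow> ('x, 'g::real_vector) vbundle \<Rightarrow> ('x, 'y, 'v, 'f, 'g) gfield set" where
  "S_inf Y E E0 = {\<Phi>. (\<exists>r. \<forall>\<kappa> \<in> acharts Y E E0. \<Phi> \<kappa> \<in> Sloc Y E \<kappa> r) \<and>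
     (\<forall>\<kappa>. \<kappa> \<notin> acharts Y E E0 \<longrightarrow> \<Phi> \<kappa> = 0) \<and> compatible Y E E0 \<Phi>}"

text \<open>\<open>P\<^sub>\<infinity>[E;Y;E\<^sub>0]\<close>.\<close>

definition P_inf ::
    "('x::topological_space, 'y, 'v::topological_space) fbundle \<Rightarrow> ('x, 'f::real_vector) vbundle
       \<Rightarrow> ('x, 'g::real_vector) vbundle \<Rightarrow> ('x, 'y, 'v, 'f, 'g) gfield set" where
  "P_inf Y E E0 = {\<Phi>. (\<exists>r. \<forall>\<kappa> \<in> acharts Y E E0. \<Phi> \<kappa> \<in> Ploc Y E E0 \<kappa> r) \<and>
     (\<forall>\<kappa>. \<kappa> \<notin> acharts Y E E0 \<longrightarrow> \<Phi> \<kappa> = 0) \<and> compatible Y E E0 \<Phi>}"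

definition S_ant ::
    "('x::topological_space, 'y, 'v::topological_space) fbundle \<Rightarrow> ('x, 'f::real_vector) vbundle
       \<Rightarrow> ('x, 'g::real_vector) vbundle \<Rightarrow> nat \<Rightarrow> ('x, 'y, 'v, 'f, 'g) gfield set" where
  "S_ant Y E E0 k = {\<Phi> \<in> S_inf Y E E0. \<forall>\<kappa>. has_ant k (\<Phi> \<kappa>)}"

definition P_ant ::
    "('x::topological_space, 'y, 'v::topological_space) fbundle \<Rightarrow> ('x, 'f::real_vector) vbundle
       \<Rightarrow> ('x, 'g::real_vector) vbundle \<Rightarrow> nat \<Rightarrow> ('x, 'y, 'v, 'f, 'g) gfield set" where
  "P_ant Y E E0 k = {\<Phi> \<in> P_inf Y E E0. \<forall>\<kappa>. has_ant k (\<Phi> \<kappa>)}"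


section \<open>Differential operators and Koszul--Tate differentials\<close>

text \<open>An \<open>E\<close>-valued differential operator on \<open>Y\<close>: functions \<open>\<E>\<^sup>a\<close> of finite jet order whose combination
  \<open>\<E>\<^sup>a b\<^sub>a\<close> with the frame does not depend on the chart, i.e. a bundle morphism \<open>J\<^sup>rY \<rightarrow> E\<close> over \<open>X\<close>.\<close>

definition is_diff_operator ::
    "('x::topological_space, 'y, 'v::topological_space) fbundle \<Rightarrow> ('x, 'f::real_vector) vbundle
       \<Rightarrow> ('x, 'g::real_vector) vbundle \<Rightarrow> (('x, 'y, 'v, 'f, 'g) achart \<Rightarrow> nat \<Rightarrow> gfun) \<Rightarrow> bool" where
  "is_diff_operator Y E E0 Op \<longleftrightarrow>
     (\<exists>r. \<forall>\<kappa> \<in> acharts Y E E0. \<forall>a < vrank E. Op \<kappa> a \<in> Oloc Y \<kappa> r) \<and>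
     (\<forall>\<kappa> \<in> acharts Y E E0. \<forall>\<kappa>' \<in> acharts Y E E0. \<forall>x s.
        covers \<kappa> x s \<and> covers \<kappa>' x s \<and> local_section Y x s \<longrightarrow>
        (\<Sum>a<vrank E. Op \<kappa> a (jet_of \<kappa> x s) [] [] *\<^sub>R snd (frE \<kappa>) a x) =
        (\<Sum>a<vrank E. Op \<kappa>' a (jet_of \<kappa>' x s) [] [] *\<^sub>R snd (frE \<kappa>') a x))"

text \<open>A derivation acts on global graded functions through its action in each chart.\<close>

definition act ::
    "('x, 'y, 'v) fbundle \<Rightarrow> ('x, 'f) vbundle \<Rightarrow> ('x, 'g) vbundle
       \<Rightarrow> (('x, 'y, 'v, 'f, 'g) achart \<Rightarrow> gfun \<Rightarrow> gfun)
       \<Rightarrow> ('x, 'y, 'v, 'f, 'g) gfield \<Rightarrow> ('x, 'y, 'v, 'f, 'g) gfield" where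
  "act Y E E0 d \<Phi> = (\<lambda>\<kappa>. if \<kappa> \<in> acharts Y E E0 then d \<kappa> (\<Phi> \<kappa>) else 0)"

text \<open>
  \<open>d\<close> is the nilpotent right derivation of \<open>P\<^sub>\<infinity>[E;Y;E\<^sub>0]\<close> that vanishes on functions, with
  \<open>d(c\<^sup>a\<^sub>\<Lambda>) = d\<^sub>\<Lambda>\<E>\<^sup>a\<close> and \<open>d(c\<^sup>r\<^sub>\<Lambda>) = d\<^sub>\<Lambda>\<Delta>\<^sup>r\<close>.  The case \<open>\<Delta> = 0\<close> is the Koszul--Tate differential \<open>\<delta>\<close>,
  extended from \<open>S\<^sub>\<infinity>[E;Y]\<close> by zero on the \<open>c\<^sup>r\<^sub>\<Lambda>\<close>; with \<open>\<Delta>\<close> the Noether operators it is \<open>\<delta>\<^sub>0\<close>.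
\<close>

definition is_KT_differential ::
    "('x::topological_space, 'y, 'v::topological_space) fbundle \<Rightarrow> ('x, 'f::real_vector) vbundle
       \<Rightarrow> ('x, 'g::real_vector) vbundle
       \<Rightarrow> (('x, 'y, 'v, 'f, 'g) achart \<Rightarrow> nat \<Rightarrow> gfun) \<Rightarrow> (('x, 'y, 'v, 'f, 'g) achart \<Rightarrow> nat \<Rightarrow> gfun)
       \<Rightarrow> (('x, 'y, 'v, 'f, 'g) achart \<Rightarrow> gfun \<Rightarrow> gfun) \<Rightarrow> bool" where
  "is_KT_differential Y E E0 Op \<Delta> d \<longleftrightarrow>
     (\<forall>\<kappa> \<in> acharts Y E E0.
        (\<forall>f \<in> (\<Union>r. Ploc Y E E0 \<kappa> r). d \<kappa> f \<in> (\<Union>r. Ploc Y E E0 \<kappa> r) \<and> d \<kappa> (d \<kappa> f) = 0) \<and>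
        (\<forall>f \<in> (\<Union>r. Ploc Y E E0 \<kappa> r). \<forall>f' \<in> (\<Union>r. Ploc Y E E0 \<kappa> r).
           d \<kappa> (f + f') = d \<kappa> f + d \<kappa> f' \<and>
           d \<kappa> (f \<odot> f') = d \<kappa> f \<odot> ginv f' + f \<odot> d \<kappa> f') \<and>
        (\<forall>f \<in> (\<Union>r. Oloc Y \<kappa> r). d \<kappa> f = 0) \<and>
        (\<forall>a < vrank E. \<forall>\<Lambda>. set_mset \<Lambda> \<subseteq> {..<mdim (base Y)} \<longrightarrow>
           d \<kappa> (c_odd \<kappa> a \<Lambda>) = total_derivs Y \<kappa> \<Lambda> (Op \<kappa> a)) \<and>
        (\<forall>i < vrank E0. \<forall>\<Lambda>. set_mset \<Lambda> \<subseteq> {..<mdim (base Y)} \<longrightarrow>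
           d \<kappa> (c_even \<kappa> i \<Lambda>) = total_derivs Y \<kappa> \<Lambda> (\<Delta> \<kappa> i))) \<and>
     (\<forall>\<Phi> \<in> P_inf Y E E0. act Y E E0 d \<Phi> \<in> P_inf Y E E0)"


section \<open>Finite generation of the first homology\<close>

definition dual_section ::
    "('x::topological_space) mfd \<Rightarrow> ('x, 'g::real_vector) vbundle \<Rightarrow> ('x \<Rightarrow> 'g \<Rightarrow> real) \<Rightarrow> bool" where
  "dual_section X E0 m \<longleftrightarrow> (\<forall>x. linear (m x)) \<and>
     (\<forall>(U, b) \<in> frames E0. \<forall>i < vrank E0. smooth_fun X U (\<lambda>x. m x (b i x)))"

definition noether_pairing ::
    "('x, 'y, 'v) fbundle \<Rightarrow> ('x, 'f) vbundle \<Rightarrow> ('x, 'g) vbundle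
       \<Rightarrow> (('x, 'y, 'v, 'f, 'g) achart \<Rightarrow> nat \<Rightarrow> gfun) \<Rightarrow> ('x \<Rightarrow> 'g \<Rightarrow> real)
       \<Rightarrow> ('x, 'y, 'v, 'f, 'g) gfield" where
  "noether_pairing Y E E0 \<Delta> m = (\<lambda>\<kappa>. if \<kappa> \<in> acharts Y E E0
     then (\<lambda>q es ws. \<Sum>i<vrank E0.
             (let x = xinv \<kappa> (\<lambda>l. q (Base l)) in m x (snd (frE0 \<kappa>) i x)) * \<Delta> \<kappa> i q es ws)
     else 0)"

text \<open>
  The \<open>\<Delta>\<^sup>r\<close> transform like the fibre coordinates \<open>c\<^sup>r\<close> of \<open>E\<^sub>0\<close> (otherwise \<open>c\<^sup>r \<mapsto> \<Delta>\<^sup>r\<close> would depend on the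
  chart), so \<open>m \<mapsto> m\<^sub>r \<Delta>\<^sup>r\<close> is a \<open>C\<^sup>\<infinity>(X)\<close>-linear map from the sections of the dual of \<open>E\<^sub>0\<close>, a bundle
  isomorphic to \<open>E\<^sub>0\<close>.  The conditions say: its values are \<open>\<delta>\<close>-cycles; it is injective modulo boundaries,
  so it is an isomorphism onto a submodule of \<open>H\<^sub>1(\<delta>)\<close>; and every class in \<open>H\<^sub>1(\<delta>)\<close> factorizes as
  \<open>\<Sum> G\<^sub>r\<^sup>\<Xi> d\<^sub>\<Xi>\<Delta>\<^sup>r\<close>, the coefficients being those of a global \<open>G = \<Sum> G\<^sub>r\<^sup>\<Xi> c\<^sup>r\<^sub>\<Xi>\<close>.
\<close>

definition generates_H1 ::
    "('x::topological_space, 'y, 'v::topological_space) fbundle \<Rightarrow> ('x, 'f::real_vector) vbundle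
       \<Rightarrow> ('x, 'g::real_vector) vbundle
       \<Rightarrow> (('x, 'y, 'v, 'f, 'g) achart \<Rightarrow> gfun \<Rightarrow> gfun)
       \<Rightarrow> (('x, 'y, 'v, 'f, 'g) achart \<Rightarrow> nat \<Rightarrow> gfun) \<Rightarrow> bool" where
  "generates_H1 Y E E0 \<delta> \<Delta> \<longleftrightarrow>
     (\<exists>r. \<forall>\<kappa> \<in> acharts Y E E0. \<forall>i < vrank E0. \<Delta> \<kappa> i \<in> Sloc Y E \<kappa> r \<and> has_ant 1 (\<Delta> \<kappa> i)) \<and>
     (\<forall>\<kappa> \<in> acharts Y E E0. \<forall>\<kappa>' \<in> acharts Y E E0. \<forall>x s e.
        covers \<kappa> x s \<and> covers \<kappa>' x s \<and> local_section Y x s \<and> local_vsection (base Y) E x e \<longrightarrow>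
        (\<Sum>i<vrank E0. \<Delta> \<kappa> i (jet_of \<kappa> x s) [vjet_E E \<kappa> x e] [] *\<^sub>R snd (frE0 \<kappa>) i x) =
        (\<Sum>i<vrank E0. \<Delta> \<kappa>' i (jet_of \<kappa>' x s) [vjet_E E \<kappa>' x e] [] *\<^sub>R snd (frE0 \<kappa>') i x)) \<and>
     (\<forall>\<kappa> \<in> acharts Y E E0. \<forall>i < vrank E0. \<delta> \<kappa> (\<Delta> \<kappa> i) = 0) \<and>
     (\<forall>m. dual_section (base Y) E0 m \<and>
          noether_pairing Y E E0 \<Delta> m \<in> act Y E E0 \<delta> ` S_ant Y E E0 2 \<longrightarrow>
          (\<forall>x. \<forall>v \<in> vfib E0 x. m x v = 0)) \<and>
     (\<forall>\<Phi> \<in> S_ant Y E E0 1. act Y E E0 \<delta> \<Phi> = 0 \<longrightarrow>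
        (\<exists>G \<in> P_ant Y E E0 2. \<exists>H \<in> S_ant Y E E0 2. \<forall>\<kappa> \<in> acharts Y E E0. \<exists>r g.
           (\<forall>i < vrank E0. \<forall>\<Xi> \<in> multi_indices (mdim (base Y)) r. g i \<Xi> \<in> (\<Union>k. Oloc Y \<kappa> k)) \<and>
           G \<kappa> = (\<Sum>i<vrank E0. \<Sum>\<Xi> \<in> multi_indices (mdim (base Y)) r. g i \<Xi> \<odot> c_even \<kappa> i \<Xi>) \<and>
           \<Phi> \<kappa> = (\<Sum>i<vrank E0. \<Sum>\<Xi> \<in> multi_indices (mdim (base Y)) r.
                     g i \<Xi> \<odot> total_derivs Y \<kappa> \<Xi> (\<Delta> \<kappa> i)) + \<delta> \<kappa> (H \<kappa>)))"


section \<open>First-stage Noether identities\<close>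

text \<open>The summand \<open>G\<close> of a two-chain \<open>\<Phi> = G + H\<close>, linear in the \<open>c\<^sup>r\<^sub>\<Lambda>\<close>.\<close>

definition G_part :: "('x, 'y, 'v, 'f, 'g) gfield \<Rightarrow> ('x, 'y, 'v, 'f, 'g) gfield" where
  "G_part \<Phi> = (\<lambda>\<kappa> q es ws. if es = [] then \<Phi> \<kappa> q es ws else 0)"

text \<open>Two senses of a graded function vanishing on \<open>Ker \<E>\<close>: pointwise, at the jets where all \<open>\<E>\<^sup>a\<close>
  vanish, and algebraically, as \<open>\<delta>\<close>-exactness, which for \<open>G = \<Sum> G\<^sub>r\<^sup>\<Lambda> c\<^sup>r\<^sub>\<Lambda>\<close> puts the coefficients into
  the ideal generated by the functions \<open>d\<^sub>\<Sigma>\<E>\<^sup>a\<close>.  Neither implies the other for a general operator.\<close>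

definition vanishes_on_Ker ::
    "('x, 'y, 'v) fbundle \<Rightarrow> ('x, 'f) vbundle \<Rightarrow> ('x, 'g) vbundle
       \<Rightarrow> (('x, 'y, 'v, 'f, 'g) achart \<Rightarrow> nat \<Rightarrow> gfun) \<Rightarrow> ('x, 'y, 'v, 'f, 'g) gfield \<Rightarrow> bool" where
  "vanishes_on_Ker Y E E0 Op G \<longleftrightarrow>
     (\<forall>\<kappa> \<in> acharts Y E E0. \<forall>q \<in> jdom \<kappa>.
        (\<forall>a < vrank E. Op \<kappa> a q [] [] = 0) \<longrightarrow> (\<forall>es ws. G \<kappa> q es ws = 0))"

definition vanishes_mod_delta ::
    "('x::topological_space, 'y, 'v::topological_space) fbundle \<Rightarrow> ('x, 'f::real_vector) vbundle
       \<Rightarrow> ('x, 'g::real_vector) vbundle \<Rightarrow> (('x, 'y, 'v, 'f, 'g) achart \<Rightarrow> gfun \<Rightarrow> gfun)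
       \<Rightarrow> ('x, 'y, 'v, 'f, 'g) gfield \<Rightarrow> bool" where
  "vanishes_mod_delta Y E E0 \<delta> G \<longleftrightarrow> G \<in> act Y E E0 \<delta> ` P_ant Y E E0 3"

definition two_cycles ::
    "('x::topological_space, 'y, 'v::topological_space) fbundle \<Rightarrow> ('x, 'f::real_vector) vbundle
       \<Rightarrow> ('x, 'g::real_vector) vbundle \<Rightarrow> (('x, 'y, 'v, 'f, 'g) achart \<Rightarrow> gfun \<Rightarrow> gfun)
       \<Rightarrow> ('x, 'y, 'v, 'f, 'g) gfield set" where
  "two_cycles Y E E0 \<delta>0 = {\<Phi> \<in> P_ant Y E E0 2. act Y E E0 \<delta>0 \<Phi> = 0}"

definition two_boundaries ::
    "('x::topological_space, 'y, 'v::topological_space) fbundle \<Rightarrow> ('x, 'f::real_vector) vbundle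
       \<Rightarrow> ('x, 'g::real_vector) vbundle \<Rightarrow> (('x, 'y, 'v, 'f, 'g) achart \<Rightarrow> gfun \<Rightarrow> gfun)
       \<Rightarrow> ('x, 'y, 'v, 'f, 'g) gfield set" where
  "two_boundaries Y E E0 \<delta>0 = act Y E E0 \<delta>0 ` P_ant Y E E0 3"

definition H2_class ::
    "('x::topological_space, 'y, 'v::topological_space) fbundle \<Rightarrow> ('x, 'f::real_vector) vbundle
       \<Rightarrow> ('x, 'g::real_vector) vbundle \<Rightarrow> (('x, 'y, 'v, 'f, 'g) achart \<Rightarrow> gfun \<Rightarrow> gfun)
       \<Rightarrow> ('x, 'y, 'v, 'f, 'g) gfield \<Rightarrow> ('x, 'y, 'v, 'f, 'g) gfield set" where
  "H2_class Y E E0 \<delta>0 \<Phi> = {\<Phi> + \<Psi> | \<Psi>. \<Psi> \<in> two_boundaries Y E E0 \<delta>0}"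

text \<open>\<open>V\<close> is the sense in which the summand \<open>G\<close> vanishes on \<open>Ker \<E>\<close>.\<close>

definition first_stage_noether_identity ::
    "('x::topological_space, 'y, 'v::topological_space) fbundle \<Rightarrow> ('x, 'f::real_vector) vbundle
       \<Rightarrow> ('x, 'g::real_vector) vbundle \<Rightarrow> (('x, 'y, 'v, 'f, 'g) achart \<Rightarrow> gfun \<Rightarrow> gfun)
       \<Rightarrow> (('x, 'y, 'v, 'f, 'g) gfield \<Rightarrow> bool) \<Rightarrow> ('x, 'y, 'v, 'f, 'g) gfield \<Rightarrow> bool" where
  "first_stage_noether_identity Y E E0 \<delta>0 V \<Phi> \<longleftrightarrow>
     \<Phi> \<in> two_cycles Y E E0 \<delta>0 \<and> \<not> (\<Phi> \<in> two_boundaries Y E E0 \<delta>0 \<or> V (G_part \<Phi>))"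

definition identities_are_H2 ::
    "('x::topological_space, 'y, 'v::topological_space) fbundle \<Rightarrow> ('x, 'f::real_vector) vbundle
       \<Rightarrow> ('x, 'g::real_vector) vbundle \<Rightarrow> (('x, 'y, 'v, 'f, 'g) achart \<Rightarrow> gfun \<Rightarrow> gfun)
       \<Rightarrow> (('x, 'y, 'v, 'f, 'g) gfield \<Rightarrow> bool) \<Rightarrow> bool" where
  "identities_are_H2 Y E E0 \<delta>0 V \<longleftrightarrow>
     (\<forall>\<Phi> \<in> two_cycles Y E E0 \<delta>0.
        first_stage_noether_identity Y E E0 \<delta>0 V \<Phi> \<longleftrightarrow>
        H2_class Y E E0 \<delta>0 \<Phi> \<noteq> H2_class Y E E0 \<delta>0 0)"

text \<open>For the pointwise sense: vanishing on \<open>Ker \<E>\<close> of a graded function linear in the \<open>c\<^sup>r\<^sub>\<Lambda>\<close> implies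
  \<open>\<delta>\<close>-exactness.\<close>

definition regular_operator ::
    "('x::topological_space, 'y, 'v::topological_space) fbundle \<Rightarrow> ('x, 'f::real_vector) vbundle
       \<Rightarrow> ('x, 'g::real_vector) vbundle
       \<Rightarrow> (('x, 'y, 'v, 'f, 'g) achart \<Rightarrow> nat \<Rightarrow> gfun)
       \<Rightarrow> (('x, 'y, 'v, 'f, 'g) achart \<Rightarrow> gfun \<Rightarrow> gfun) \<Rightarrow> bool" where
  "regular_operator Y E E0 Op \<delta> \<longleftrightarrow>
     (\<forall>G \<in> P_ant Y E E0 2. G_part G = G \<and> vanishes_on_Ker Y E E0 Op G \<longrightarrow>
        vanishes_mod_delta Y E E0 \<delta> G)"

end

theory Submission
  imports Defs
begin

text \<open>
  Since the boundaries form a subgroup, the identification says that a two-cycle \<open>\<Phi> = G + H\<close> whose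
  summand \<open>G\<close> vanishes on \<open>Ker \<E>\<close> is a boundary.  For \<open>\<delta>\<close>-cycles in \<open>S\<^sub>\<infinity>[E;Y]\<close> this is the stated
  condition, as there \<open>G = 0\<close> and \<open>\<delta>\<^sub>0 = \<delta>\<close>.  Conversely, if \<open>G = \<delta>\<Psi>\<close>, then \<open>\<delta>\<^sub>0\<Psi>\<close> has the same summand
  \<open>G\<close>, so \<open>\<Phi> - \<delta>\<^sub>0\<Psi>\<close> is a \<open>\<delta>\<close>-cycle in the odd generators alone and homologous to \<open>\<Phi>\<close>.
\<close>

section \<open>Rescaling graded functions by their numbers of odd and even generators\<close>

text \<open>The arguments of \<open>w\<close> are the degrees in the odd and in the even generators.
  Weights with values 0 and 1 give projections onto parts of the algebra, while powers of 2 record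
  the antifield number.\<close>

definition weighted :: "(nat \<Rightarrow> nat \<Rightarrow> real) \<Rightarrow> gfun \<Rightarrow> gfun" where
  "weighted w f = (\<lambda>q es ws. w (length es) (length ws) * f q es ws)"

text \<open>A monoid homomorphism from pairs of degrees under addition to the reals under
  multiplication; this is what makes \<open>weighted w\<close> a ring endomorphism.\<close>

definition multiplicative :: "(nat \<Rightarrow> nat \<Rightarrow> real) \<Rightarrow> bool" where
  "multiplicative w \<longleftrightarrow> w 0 0 = 1 \<and> (\<forall>a b a' b'. w (a + a') (b + b') = w a b * w a' b')"

lemma length_nths_add_compl: "length (nths xs A) + length (nths xs (- A)) = length xs"
proof -
  have "{i. i < length xs \<and> i \<in> A} \<union> {i. i < length xs \<and> i \<in> - A} = {..<length xs}"
    by auto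
  then have "card {..<length xs} =
      card {i. i < length xs \<and> i \<in> A} + card {i. i < length xs \<and> i \<in> - A}"
    by (metis (no_types, lifting) card_Un_disjoint finite_Un finite_lessThan
        disjoint_iff ComplD mem_Collect_eq)
  then show ?thesis
    by (simp add: length_nths)
qed

text \<open>Every term of the shuffle product distributes the arguments over the two factors, so the
  degrees add up and the weight splits accordingly.\<close>

lemma weighted_gmul:
  assumes "multiplicative w"
  shows "weighted w (f \<odot> g) = weighted w f \<odot> weighted w g"
proof (intro ext)
  fix q and es ws :: "vjet list"
  have w: "w (length es) (length ws) =
      w (length (nths es A)) (length (nths ws B)) * w (length (nths es (- A))) (length (nths ws (- B)))"
    for A B
    using assms unfolding multiplicative_def by (metis length_nths_add_compl)
  have "w (length es) (length ws) * (s * x * y) =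
      s * (w (length (nths es A)) (length (nths ws B)) * x) *
        (w (length (nths es (- A))) (length (nths ws (- B))) * y)" for s x y A B
    by (subst w[of A B]) (simp add: mult_ac)
  then show "weighted w (f \<odot> g) q es ws = (weighted w f \<odot> weighted w g) q es ws"
    unfolding weighted_def gmul_def sum_distrib_left by (intro sum.cong refl)
qed

lemma weighted_add: "weighted w (f + g) = weighted w f + weighted w g"
  by (simp add: weighted_def fun_eq_iff distrib_left)

lemma weighted_ginv: "weighted w (ginv f) = ginv (weighted w f)"
  by (simp add: weighted_def ginv_def mult_ac)

lemma gmul_zero [simp]: "0 \<odot> f = 0" "f \<odot> 0 = 0"
  by (simp_all add: gmul_def fun_eq_iff)

lemma gmul_scale:
  "(\<lambda>q es ws. c * f q es ws) \<odot> g = (\<lambda>q es ws. c * (f \<odot> g) q es ws)"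
  "f \<odot> (\<lambda>q es ws. c * g q es ws) = (\<lambda>q es ws. c * (f \<odot> g) q es ws)"
  by (simp_all add: gmul_def fun_eq_iff sum_distrib_left mult_ac)

section \<open>Real constants inside the local algebras\<close>

text \<open>\<open>generated\<close> closes under sums and products only, and the differentials are
  only required to be additive and to obey the product rule. Real scalars therefore enter as
  constant functions, cut off outside \<open>jdom \<kappa>\<close> like every element of
  \<open>Oloc\<close>.\<close>

definition const_gfun :: "('x, 'y, 'v, 'f, 'g) achart \<Rightarrow> real \<Rightarrow> gfun" where
  "const_gfun \<kappa> c = (\<lambda>q es ws. if q \<in> jdom \<kappa> \<and> es = [] \<and> ws = [] then c else 0)"

lemma partials_const: "partials is (\<lambda>_. c) = (\<lambda>_. if is = [] then c else 0)"
proof (induction "is")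
  case (Cons i "is")
  then have "partials (i # is) (\<lambda>_. c) = partial i (\<lambda>_. if is = [] then c else 0)"
    by (simp add: partials_def)
  then show ?case by (simp add: partial_def fun_eq_iff)
qed (simp add: partials_def)

lemma const_in_Oloc: "const_gfun \<kappa> c \<in> Oloc Y \<kappa> r"
proof -
  have "smooth_on (jvars Y r) (jdom \<kappa> \<inter> coord_space (jvars Y r)) (\<lambda>_. c)"
    by (simp add: smooth_on_def partials_const)
  then show ?thesis
    unfolding Oloc_def const_gfun_def by (intro CollectI exI[of _ "\<lambda>_. c"]) simp
qed

lemma zero_in_Oloc: "0 \<in> Oloc Y \<kappa> r"
  using const_in_Oloc[of \<kappa> 0 Y r] by (simp add: const_gfun_def zero_fun_def)

lemma nths_eq_Nil_iff: "A \<subseteq> {..<length xs} \<Longrightarrow> nths xs A = [] \<longleftrightarrow> A = {}"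
proof -
  assume "A \<subseteq> {..<length xs}"
  then have "{i. i < length xs \<and> i \<in> A} = A" by auto
  moreover have "finite A"
    using \<open>A \<subseteq> {..<length xs}\<close> finite_subset by blast
  ultimately have "length (nths xs A) = 0 \<longleftrightarrow> A = {}"
    by (simp add: length_nths)
  then show ?thesis by simp
qed

text \<open>A constant accepts only empty argument lists, so a single term of the shuffle sum
  survives, the one with \<open>A = {}\<close> and \<open>B = {}\<close>, whose sign is 1. The
  hypothesis settles the points outside \<open>jdom \<kappa>\<close>, where the constant is cut
  off.\<close>

lemma const_gmul:
  assumes "\<And>q es ws. q \<notin> jdom \<kappa> \<Longrightarrow> f q es ws = 0"
  shows "const_gfun \<kappa> c \<odot> f = (\<lambda>q es ws. c * f q es ws)"
proof (intro ext)
  fix q es ws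
  let ?t = "\<lambda>A B. shuffle_sgn A (length es) * const_gfun \<kappa> c q (nths es A) (nths ws B) *
    f q (nths es (- A)) (nths ws (- B))"
  have "(const_gfun \<kappa> c \<odot> f) q es ws = (\<Sum>A\<in>Pow {..<length es}. \<Sum>B\<in>Pow {..<length ws}. ?t A B)"
    by (simp add: gmul_def)
  also have "\<dots> = (\<Sum>A\<in>{{}}. \<Sum>B\<in>Pow {..<length ws}. ?t A B)"
    by (rule sum.mono_neutral_right) (auto simp: const_gfun_def nths_eq_Nil_iff)
  also have "\<dots> = (\<Sum>B\<in>Pow {..<length ws}. ?t {} B)"
    by simp
  also have "\<dots> = (\<Sum>B\<in>{{}}. ?t {} B)"
    by (rule sum.mono_neutral_right) (auto simp: const_gfun_def nths_eq_Nil_iff)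
  also have "\<dots> = c * f q es ws"
    using assms by (simp add: const_gfun_def shuffle_sgn_def nths_all)
  finally show "(const_gfun \<kappa> c \<odot> f) q es ws = c * f q es ws" .
qed

section \<open>Membership in the local algebras\<close>

lemma generated_mono: "A \<subseteq> generated B \<Longrightarrow> f \<in> generated A \<Longrightarrow> f \<in> generated B"
  by (erule generated.induct) (blast, (rule generated.intros; assumption)+)

lemma Ploc_jdom:
  assumes "f \<in> Ploc Y E E0 \<kappa> r" "q \<notin> jdom \<kappa>"
  shows "f q es ws = 0"
  using assms(1) unfolding Ploc_def
proof (induction arbitrary: es ws)
  case (gen f)
  then show ?case
    using assms(2) by (auto simp: Oloc_def c_odd_def c_even_def)
next
  case (mul f g)
  then show ?case by (simp add: gmul_def)
qed simp

lemma Sloc_subset_Ploc: "Sloc Y E \<kappa> r \<subseteq> Ploc Y E E0 \<kappa> r"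
  unfolding Sloc_def Ploc_def by (rule subsetI, erule generated_mono[rotated]) (blast intro: generated.gen)

lemma zero_in_Sloc: "0 \<in> Sloc Y E \<kappa> r"
  unfolding Sloc_def by (intro generated.gen UnI1 zero_in_Oloc)

lemma const_gmul_Ploc:
  "f \<in> Ploc Y E E0 \<kappa> r \<Longrightarrow> const_gfun \<kappa> c \<odot> f = (\<lambda>q es ws. c * f q es ws)"
  by (rule const_gmul) (rule Ploc_jdom)

lemma Ploc_scale:
  assumes "f \<in> Ploc Y E E0 \<kappa> r"
  shows "(\<lambda>q es ws. c * f q es ws) \<in> Ploc Y E E0 \<kappa> r"
proof -
  have "const_gfun \<kappa> c \<in> Ploc Y E E0 \<kappa> r"
    unfolding Ploc_def by (intro generated.gen UnI1 const_in_Oloc)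
  then have "const_gfun \<kappa> c \<odot> f \<in> Ploc Y E E0 \<kappa> r"
    using assms unfolding Ploc_def by (rule generated.mul)
  then show ?thesis
    by (simp add: const_gmul_Ploc[OF assms])
qed

lemma weighted_generators:
  assumes "multiplicative w"
  shows "f \<in> Oloc Y \<kappa> r \<Longrightarrow> weighted w f = f"
    and "weighted w (c_odd \<kappa> a \<Lambda>) = (\<lambda>q es ws. w 1 0 * c_odd \<kappa> a \<Lambda> q es ws)"
    and "weighted w (c_even \<kappa> i \<Lambda>) = (\<lambda>q es ws. w 0 1 * c_even \<kappa> i \<Lambda> q es ws)"
  using assms by (auto simp: weighted_def multiplicative_def Oloc_def c_odd_def c_even_def fun_eq_iff)

text \<open>Compared with plain induction on \<open>generated\<close>, the cases for odd and even
  generators, sums and products also supply membership in \<open>Ploc\<close>, which the additivity,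
  the product rule and the homogeneity of the differentials take as premises.\<close>

lemma Ploc_induct [consumes 1, case_names smooth odd even add mul]:
  assumes "f \<in> Ploc Y E E0 \<kappa> r"
    and "\<And>f. f \<in> Oloc Y \<kappa> r \<Longrightarrow> P f"
    and "\<And>a \<Lambda>. a < vrank E \<Longrightarrow> \<Lambda> \<in> multi_indices (mdim (base Y)) r \<Longrightarrow>
      c_odd \<kappa> a \<Lambda> \<in> Ploc Y E E0 \<kappa> r \<Longrightarrow> P (c_odd \<kappa> a \<Lambda>)"
    and "\<And>i \<Lambda>. i < vrank E0 \<Longrightarrow> \<Lambda> \<in> multi_indices (mdim (base Y)) r \<Longrightarrow>
      c_even \<kappa> i \<Lambda> \<in> Ploc Y E E0 \<kappa> r \<Longrightarrow> P (c_even \<kappa> i \<Lambda>)"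
    and "\<And>f g. f \<in> Ploc Y E E0 \<kappa> r \<Longrightarrow> g \<in> Ploc Y E E0 \<kappa> r \<Longrightarrow> P f \<Longrightarrow> P g \<Longrightarrow> P (f + g)"
    and "\<And>f g. f \<in> Ploc Y E E0 \<kappa> r \<Longrightarrow> g \<in> Ploc Y E E0 \<kappa> r \<Longrightarrow> P f \<Longrightarrow> P g \<Longrightarrow> P (f \<odot> g)"
  shows "P f"
  using assms(1) unfolding Ploc_def
proof induction
  case (gen f)
  then have "f \<in> Ploc Y E E0 \<kappa> r"
    unfolding Ploc_def by (rule generated.gen)
  with gen assms(2-4) show ?case by auto
next
  case (add f g)
  then show ?case
    by (intro assms(5)) (simp_all only: Ploc_def)
next
  case (mul f g)
  then show ?case
    by (intro assms(6)) (simp_all only: Ploc_def)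
qed

text \<open>Generators are homogeneous, so a weight only scales them; sums and products follow
  because weighting is a ring homomorphism.\<close>

lemma weighted_in_Ploc:
  assumes "multiplicative w" "f \<in> Ploc Y E E0 \<kappa> r"
  shows "weighted w f \<in> Ploc Y E E0 \<kappa> r"
  using assms(2)
proof (induction rule: Ploc_induct)
  case (smooth f)
  then show ?case
    by (auto simp: weighted_generators[OF assms(1)] Ploc_def intro: generated.gen)
next
  case (add f g)
  then show ?case unfolding weighted_add Ploc_def by (intro generated.add)
next
  case (mul f g)
  then show ?case unfolding weighted_gmul[OF assms(1)] Ploc_def by (intro generated.mul)
qed (simp_all only: weighted_generators[OF assms(1)] Ploc_scale)

text \<open>The first weight encodes the antifield number, the second sets all odd generators to
  zero, the third all even ones. The last two are multiplicative because a sum of naturals is 0 only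
  if both summands are.\<close>

lemma multiplicative_weights:
  "multiplicative (\<lambda>a b. 2 ^ (a + 2 * b))"
  "multiplicative (\<lambda>a b. if a = 0 then 1 else 0)"
  "multiplicative (\<lambda>a b. if b = 0 then 1 else 0)"
  by (auto simp: multiplicative_def power_add algebra_simps)

text \<open>Setting the even generators to zero is a ring homomorphism that maps the generators of
  \<open>Ploc\<close> into \<open>Sloc\<close>, and it fixes \<open>f\<close> by the second
  hypothesis.\<close>

lemma Ploc_no_even_in_Sloc:
  assumes "f \<in> Ploc Y E E0 \<kappa> r" and "\<And>q es ws. ws \<noteq> [] \<Longrightarrow> f q es ws = 0"
  shows "f \<in> Sloc Y E \<kappa> r"
proof -
  let ?w = "\<lambda>a b. if b = 0 then 1 else 0 :: real"
  have "weighted ?w f \<in> Sloc Y E \<kappa> r"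
    using assms(1)
  proof (induction rule: Ploc_induct)
    case (smooth f)
    then show ?case
      by (auto simp: weighted_generators[OF multiplicative_weights(3)] Sloc_def intro: generated.gen)
  next
    case (odd a \<Lambda>)
    then have "c_odd \<kappa> a \<Lambda> \<in> Sloc Y E \<kappa> r"
      unfolding Sloc_def by (blast intro: generated.gen)
    then show ?case
      by (simp add: weighted_generators[OF multiplicative_weights(3)])
  next
    case (even i \<Lambda>)
    then show ?case
      using zero_in_Sloc[of Y E \<kappa> r]
      by (simp add: weighted_generators[OF multiplicative_weights(3)] zero_fun_def)
  next
    case (add f g)
    then show ?case unfolding weighted_add Sloc_def by (intro generated.add)
  next
    case (mul f g)
    then show ?case unfolding weighted_gmul[OF multiplicative_weights(3)] Sloc_def by (intro generated.mul)
  qed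
  moreover have "weighted ?w f = f"
    using assms(2) by (auto simp: weighted_def fun_eq_iff)
  ultimately show ?thesis by simp
qed

text \<open>The same projection fixes all generators of \<open>Sloc\<close>, hence all of
  \<open>Sloc\<close>.\<close>

lemma Sloc_no_even:
  assumes "f \<in> Sloc Y E \<kappa> r" "ws \<noteq> []"
  shows "f q es ws = 0"
proof -
  let ?w = "\<lambda>a b. if b = 0 then 1 else 0 :: real"
  have "weighted ?w f = f"
    using assms(1) unfolding Sloc_def
  proof induction
    case (gen f)
    then show ?case
      by (auto simp: weighted_generators[OF multiplicative_weights(3)])
  qed (simp_all only: weighted_add weighted_gmul[OF multiplicative_weights(3)])
  then have "f q es ws = weighted ?w f q es ws" by simp
  then show ?thesis using assms(2) by (simp add: weighted_def)
qed

section \<open>Raising the jet order\<close>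

text \<open>Composition with \<open>restr I\<close> is pull-back along a coordinate projection:
  lines in a direction from \<open>I\<close> are carried to lines in the same direction, all other
  coordinate lines are collapsed to a point.\<close>

lemma partial_restr:
  "partial i (f \<circ> restr I) = (if i \<in> I then partial i f \<circ> restr I else (\<lambda>_. 0))"
proof (cases "i \<in> I")
  case True
  then have "restr I (q(i := t)) = (restr I q)(i := t)" for q t
    by (auto simp: restr_def)
  moreover have "restr I q i = q i" for q
    using True by (simp add: restr_def)
  ultimately show ?thesis
    using True by (intro ext) (simp add: partial_def)
next
  case False
  then have "restr I (q(i := t)) = restr I q" for q t
    by (auto simp: restr_def)
  with False show ?thesis by (intro ext) (simp add: partial_def)
qed

lemma partials_Cons: "partials (i # is) f = partial i (partials is f)"
  by (simp add: partials_def)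

lemma partials_restr:
  "partials is (f \<circ> restr I) = (if set is \<subseteq> I then partials is f \<circ> restr I else (\<lambda>_. 0))"
proof (induction "is")
  case (Cons i "is")
  show ?case
  proof (cases "set is \<subseteq> I")
    case True
    then show ?thesis
      unfolding partials_Cons Cons by (simp only: if_True partial_restr) simp
  next
    case False
    then show ?thesis
      unfolding partials_Cons Cons by (intro ext) (simp add: partial_def)
  qed
qed (simp add: partials_def)

lemma Oloc_mono:
  assumes "r \<le> r'"
  shows "Oloc Y \<kappa> r \<subseteq> Oloc Y \<kappa> r'"
proof
  fix f assume "f \<in> Oloc Y \<kappa> r"
  let ?J = "jvars Y r" and ?J' = "jvars Y r'"
  let ?U = "jdom \<kappa> \<inter> coord_space ?J" and ?U' = "jdom \<kappa> \<inter> coord_space ?J'"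
  obtain F where F: "smooth_on ?J ?U F"
    and f: "f = (\<lambda>q es ws. if q \<in> jdom \<kappa> \<and> es = [] \<and> ws = [] then F (restr ?J q) else 0)"
    using \<open>f \<in> Oloc Y \<kappa> r\<close> unfolding Oloc_def by auto
  have J: "?J \<subseteq> ?J'"
    using assms unfolding jvars_def multi_indices_def by fastforce
  \<comment> \<open>Membership in \<open>jdom\<close> depends only on the base coordinates and on
    the fibre coordinates of order 0. These survive the restriction at every jet order, so
    truncation does not leave the domain.\<close>
  have restr_U: "restr ?J q \<in> ?U" if "q \<in> ?U'" for q
  proof -
    have "restr ?J q (Base i) = q (Base i)" for i
      using that by (auto simp: restr_def coord_space_def jvars_def)
    moreover have "restr ?J q (Fib i {#}) = q (Fib i {#})" for i
      using that by (auto simp: restr_def coord_space_def jvars_def multi_indices_def)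
    ultimately have "restr ?J q \<in> jdom \<kappa>"
      using that by (simp add: jdom_def)
    then show ?thesis by (simp add: coord_space_def restr_def)
  qed
  have cont_restr: "continuous_on ?U' (restr ?J)"
    unfolding restr_def
  proof (rule continuous_on_coordinatewise_then_product)
    fix j show "continuous_on ?U' (\<lambda>q. if j \<in> ?J then q j else 0)"
      by (cases "j \<in> ?J") (auto intro: continuous_on_subset[OF continuous_on_product_coordinates])
  qed
  \<comment> \<open>The witness at order \<open>r'\<close> is the pull-back of \<open>F\<close>
    under the projection from jets of order \<open>r'\<close> to jets of order
    \<open>r\<close>.\<close>
  have "smooth_on ?J' ?U' (F \<circ> restr ?J)"
    unfolding smooth_on_def
  proof (intro ballI conjI)
    fix "is" assume "is \<in> lists ?J'"
    have cont: "continuous_on ?U (partials is F)" if "set is \<subseteq> ?J"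
      using F that by (auto simp: smooth_on_def lists_eq_set)
    have "continuous_on ?U' (partials is F \<circ> restr ?J)" if "set is \<subseteq> ?J"
      by (rule continuous_on_compose[OF cont_restr continuous_on_subset[OF cont[OF that]]])
         (use restr_U in blast)
    then show "continuous_on ?U' (partials is (F \<circ> restr ?J))"
      by (simp only: partials_restr) simp
    fix i q assume "i \<in> ?J'" "q \<in> ?U'"
    show "(\<lambda>t. partials is (F \<circ> restr ?J) (q(i := t))) field_differentiable at (q i)"
    proof (cases "set is \<subseteq> ?J \<and> i \<in> ?J")
      case True
      then have "restr ?J (q(i := t)) = (restr ?J q)(i := t)" "restr ?J q i = q i" for t
        by (auto simp: restr_def)
      moreover have "(\<lambda>t. partials is F ((restr ?J q)(i := t))) field_differentiable at (restr ?J q i)"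
        using F True restr_U[OF \<open>q \<in> ?U'\<close>] by (auto simp: smooth_on_def lists_eq_set)
      ultimately show ?thesis
        using True by (simp add: partials_restr)
    next
      case False
      \<comment> \<open>Here the function of \<open>t\<close> is constant: either the iterated
        derivative contains a variable outside \<open>?J\<close> and is zero, or the projection
        forgets the coordinate \<open>i\<close>.\<close>
      have "restr ?J (q(i := t)) = restr ?J q" if "i \<notin> ?J" for t
        using that by (auto simp: restr_def)
      with False show ?thesis by (auto simp: partials_restr)
    qed
  qed
  moreover have "restr ?J (restr ?J' q) = restr ?J q" for q
    using J by (force simp: restr_def)
  ultimately show "f \<in> Oloc Y \<kappa> r'"
    unfolding Oloc_def f by (intro CollectI exI[of _ "F \<circ> restr ?J"] conjI) (simp_all cong: if_cong)
qed

lemma Ploc_mono: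
  assumes "r \<le> r'"
  shows "Ploc Y E E0 \<kappa> r \<subseteq> Ploc Y E E0 \<kappa> r'"
proof -
  have "multi_indices n r \<subseteq> multi_indices n r'" for n
    using assms by (auto simp: multi_indices_def)
  then show ?thesis
    using Oloc_mono[OF assms, of Y \<kappa>] unfolding Ploc_def
    by (intro subsetI, elim generated_mono[rotated]) (blast intro: generated.gen)
qed

section \<open>Total derivatives and local properties of the differentials\<close>

lemma partial_zero: "partial i (\<lambda>_. 0) q = 0"
  by (simp add: partial_def)

text \<open>Every summand evaluates \<open>f\<close>, or a partial derivative of it, on lists of the
  same lengths: a shift alters one argument but not the number of arguments.\<close>

lemma has_ant_total_deriv:
  assumes "has_ant k f"
  shows "has_ant k (total_deriv Y \<kappa> l f)"
proof -
  have f0: "f q es ws = 0" if "length es + 2 * length ws \<noteq> k" for q es ws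
    using assms that unfolding has_ant_def by blast
  show ?thesis
    unfolding has_ant_def
  proof (intro allI impI)
    fix q es ws
    assume "total_deriv Y \<kappa> l f q es ws \<noteq> 0"
    then show "length es + 2 * length ws = k"
      by (rule contrapos_np) (simp add: total_deriv_def f0 partial_zero)
  qed
qed

lemma has_ant_total_derivs:
  assumes "has_ant k f"
  shows "has_ant k (total_derivs Y \<kappa> \<Lambda> f)"
proof -
  have "has_ant k (foldr (total_deriv Y \<kappa>) ls f)" for ls
    using assms by (induction ls) (simp_all add: has_ant_total_deriv)
  then show ?thesis by (simp add: total_derivs_def)
qed

lemma KT_differentialD:
  assumes "is_KT_differential Y E E0 Op \<Delta> d" "\<kappa> \<in> acharts Y E E0"
  shows "f \<in> Ploc Y E E0 \<kappa> r \<Longrightarrow> \<exists>r'. d \<kappa> f \<in> Ploc Y E E0 \<kappa> r'"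
    and "f \<in> Ploc Y E E0 \<kappa> r \<Longrightarrow> d \<kappa> (d \<kappa> f) = 0"
    and "f \<in> Ploc Y E E0 \<kappa> r \<Longrightarrow> g \<in> Ploc Y E E0 \<kappa> r' \<Longrightarrow> d \<kappa> (f + g) = d \<kappa> f + d \<kappa> g"
    and "f \<in> Ploc Y E E0 \<kappa> r \<Longrightarrow> g \<in> Ploc Y E E0 \<kappa> r' \<Longrightarrow>
      d \<kappa> (f \<odot> g) = d \<kappa> f \<odot> ginv g + f \<odot> d \<kappa> g"
    and "f \<in> Oloc Y \<kappa> r \<Longrightarrow> d \<kappa> f = 0"
    and "a < vrank E \<Longrightarrow> \<Lambda> \<in> multi_indices (mdim (base Y)) r \<Longrightarrow>
      d \<kappa> (c_odd \<kappa> a \<Lambda>) = total_derivs Y \<kappa> \<Lambda> (Op \<kappa> a)"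
    and "i < vrank E0 \<Longrightarrow> \<Lambda> \<in> multi_indices (mdim (base Y)) r \<Longrightarrow>
      d \<kappa> (c_even \<kappa> i \<Lambda>) = total_derivs Y \<kappa> \<Lambda> (\<Delta> \<kappa> i)"
proof -
  note d = bspec[OF conjunct1[OF assms(1)[unfolded is_KT_differential_def]] assms(2)]
  note d1 = conjunct1[OF d] and d2 = conjunct1[OF conjunct2[OF d]]
    and d3 = conjunct1[OF conjunct2[OF conjunct2[OF d]]]
    and d4 = conjunct1[OF conjunct2[OF conjunct2[OF conjunct2[OF d]]]]
    and d5 = conjunct2[OF conjunct2[OF conjunct2[OF conjunct2[OF d]]]]
  show "\<exists>r'. d \<kappa> f \<in> Ploc Y E E0 \<kappa> r'" "d \<kappa> (d \<kappa> f) = 0" if "f \<in> Ploc Y E E0 \<kappa> r"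
    using bspec[OF d1, of f] that by auto
  show "d \<kappa> (f + g) = d \<kappa> f + d \<kappa> g" "d \<kappa> (f \<odot> g) = d \<kappa> f \<odot> ginv g + f \<odot> d \<kappa> g"
    if "f \<in> Ploc Y E E0 \<kappa> r" "g \<in> Ploc Y E E0 \<kappa> r'"
  proof -
    have "f \<in> (\<Union>r. Ploc Y E E0 \<kappa> r)" "g \<in> (\<Union>r. Ploc Y E E0 \<kappa> r)"
      using that by blast+
    from bspec[OF bspec[OF d2 this(1)] this(2)]
    show "d \<kappa> (f + g) = d \<kappa> f + d \<kappa> g" "d \<kappa> (f \<odot> g) = d \<kappa> f \<odot> ginv g + f \<odot> d \<kappa> g"
      by (rule conjunct1, rule conjunct2)
  qed
  show "d \<kappa> f = 0" if "f \<in> Oloc Y \<kappa> r"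
    using bspec[OF d3, of f] that by blast
  show "d \<kappa> (c_odd \<kappa> a \<Lambda>) = total_derivs Y \<kappa> \<Lambda> (Op \<kappa> a)"
    if "a < vrank E" "\<Lambda> \<in> multi_indices (mdim (base Y)) r"
    using d4 that unfolding multi_indices_def by simp
  show "d \<kappa> (c_even \<kappa> i \<Lambda>) = total_derivs Y \<kappa> \<Lambda> (\<Delta> \<kappa> i)"
    if "i < vrank E0" "\<Lambda> \<in> multi_indices (mdim (base Y)) r"
    using d5 that unfolding multi_indices_def by simp
qed

text \<open>Constants lie in \<open>Oloc\<close> and are killed by \<open>d\<close>, so the product
  rule turns additivity into real homogeneity.\<close>

lemma KT_scale:
  assumes d: "is_KT_differential Y E E0 Op \<Delta> d" "\<kappa> \<in> acharts Y E E0"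
    and f: "f \<in> Ploc Y E E0 \<kappa> r"
  shows "d \<kappa> (\<lambda>q es ws. c * f q es ws) = (\<lambda>q es ws. c * d \<kappa> f q es ws)"
proof -
  obtain r' where r': "d \<kappa> f \<in> Ploc Y E E0 \<kappa> r'"
    using KT_differentialD(1)[OF d f] by blast
  have c: "const_gfun \<kappa> c \<in> Ploc Y E E0 \<kappa> r"
    unfolding Ploc_def by (intro generated.gen UnI1 const_in_Oloc)
  have "d \<kappa> (const_gfun \<kappa> c \<odot> f) = const_gfun \<kappa> c \<odot> d \<kappa> f"
    by (simp add: KT_differentialD(4)[OF d c f] KT_differentialD(5)[OF d const_in_Oloc])
  then show ?thesis
    by (simp add: const_gmul_Ploc[OF f] const_gmul_Ploc[OF r'])
qed

text \<open>A derivation is determined by its values on generators, and on functions and odd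
  generators these values depend on \<open>Op\<close> alone.\<close>

lemma KT_differentials_agree_on_Sloc:
  assumes d: "is_KT_differential Y E E0 Op \<Delta> d"
    and d': "is_KT_differential Y E E0 Op \<Delta>' d'"
    and \<kappa>: "\<kappa> \<in> acharts Y E E0" and f: "f \<in> Sloc Y E \<kappa> r"
  shows "d \<kappa> f = d' \<kappa> f"
  using f unfolding Sloc_def
proof induction
  case (gen f)
  then show ?case
    using KT_differentialD(5,6)[OF d \<kappa>] KT_differentialD(5,6)[OF d' \<kappa>] by auto
next
  case (add f g)
  then have fg: "f \<in> Ploc Y E E0 \<kappa> r" "g \<in> Ploc Y E E0 \<kappa> r"
    using Sloc_subset_Ploc unfolding Sloc_def by blast+
  with add.IH show ?case
    by (simp only: KT_differentialD(3)[OF d \<kappa> fg] KT_differentialD(3)[OF d' \<kappa> fg])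
next
  case (mul f g)
  then have fg: "f \<in> Ploc Y E E0 \<kappa> r" "g \<in> Ploc Y E E0 \<kappa> r"
    using Sloc_subset_Ploc unfolding Sloc_def by blast+
  with mul.IH show ?case
    by (simp only: KT_differentialD(4)[OF d \<kappa> fg] KT_differentialD(4)[OF d' \<kappa> fg])
qed

text \<open>Parity: without odd arguments the antifield number is even.\<close>

lemma has_ant_1_Nil: "has_ant 1 f \<Longrightarrow> f q [] ws = 0"
  unfolding has_ant_def by fastforce

text \<open>The difference of the two differentials is a derivation that turns an even generator into an
  odd one, so its values have no component without odd generators.\<close>

lemma KT_differentials_agree_without_odd:
  assumes d: "is_KT_differential Y E E0 Op \<Delta> d"
    and d': "is_KT_differential Y E E0 Op \<Delta>' d'"
    and \<kappa>: "\<kappa> \<in> acharts Y E E0"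
    and \<Delta>: "\<And>i. i < vrank E0 \<Longrightarrow> has_ant 1 (\<Delta> \<kappa> i)"
    and \<Delta>': "\<And>i. i < vrank E0 \<Longrightarrow> has_ant 1 (\<Delta>' \<kappa> i)"
    and f: "f \<in> Ploc Y E E0 \<kappa> r"
  shows "d \<kappa> f q [] ws = d' \<kappa> f q [] ws"
  using f
\<comment> \<open>The even arguments are generalized because a product distributes them over its
  factors. An empty list of odd arguments stays empty for both factors, so the induction hypotheses
  apply to each of them.\<close>
proof (induction arbitrary: ws rule: Ploc_induct)
  case (smooth f)
  then show ?case
    by (simp add: KT_differentialD(5)[OF d \<kappa>] KT_differentialD(5)[OF d' \<kappa>])
next
  case (odd a \<Lambda>)
  then show ?case
    by (simp add: KT_differentialD(6)[OF d \<kappa>] KT_differentialD(6)[OF d' \<kappa>])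
next
  case (even i \<Lambda>)
  then show ?case
    by (simp add: KT_differentialD(7)[OF d \<kappa>] KT_differentialD(7)[OF d' \<kappa>]
        has_ant_1_Nil[OF has_ant_total_derivs[OF \<Delta>]] has_ant_1_Nil[OF has_ant_total_derivs[OF \<Delta>']])
next
  case (add f g)
  then show ?case
    unfolding KT_differentialD(3)[OF d \<kappa> add(1,2)] KT_differentialD(3)[OF d' \<kappa> add(1,2)] by simp
next
  case (mul f g)
  then show ?case
    unfolding KT_differentialD(4)[OF d \<kappa> mul(1,2)] KT_differentialD(4)[OF d' \<kappa> mul(1,2)]
    by (simp add: gmul_def)
qed

section \<open>The differentials lower the antifield number by one\<close>

abbreviation ant_weight :: "nat \<Rightarrow> nat \<Rightarrow> real" where
  "ant_weight \<equiv> \<lambda>a b. 2 ^ (a + 2 * b)"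

text \<open>Homogeneity becomes an eigenvector condition; no information is lost because distinct
  powers of 2 are different.\<close>

lemma has_ant_iff_weighted:
  "has_ant k f \<longleftrightarrow> weighted ant_weight f = (\<lambda>q es ws. 2 ^ k * f q es ws)"
proof -
  have "ant_weight (length es) (length ws) * f q es ws = 2 ^ k * f q es ws \<longleftrightarrow>
      (f q es ws \<noteq> 0 \<longrightarrow> length es + 2 * length ws = k)" for q es ws
    by auto
  then show ?thesis
    unfolding has_ant_def weighted_def fun_eq_iff by simp
qed

text \<open>Multiplying the part of antifield number \<open>k\<close> by \<open>2\<^sup>k\<close> is a ring homomorphism, which turns the
  grading into an identity that can be checked on generators.\<close>

lemma weighted_KT:
  assumes d: "is_KT_differential Y E E0 Op \<Delta> d"
    and \<kappa>: "\<kappa> \<in> acharts Y E E0"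
    and Op: "\<And>a. a < vrank E \<Longrightarrow> has_ant 0 (Op \<kappa> a)"
    and \<Delta>: "\<And>i. i < vrank E0 \<Longrightarrow> has_ant 1 (\<Delta> \<kappa> i)"
    and f: "f \<in> Ploc Y E E0 \<kappa> r"
  shows "d \<kappa> (weighted ant_weight f) = (\<lambda>q es ws. 2 * weighted ant_weight (d \<kappa> f) q es ws)"
proof -
  note w = multiplicative_weights(1)
  note D = KT_differentialD[OF d \<kappa>]
  show ?thesis
    using f
  proof (induction rule: Ploc_induct)
    case (smooth f)
    then show ?case
      by (simp add: weighted_generators(1)[OF w] D(5)) (simp add: weighted_def)
  next
    case (odd a \<Lambda>)
    \<comment> \<open>An odd generator has weight 2 and its image weight 1; in the next case an even
      generator has weight 4 and its image weight 2. Both ratios are the required factor 2.\<close>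
    have "has_ant 0 (d \<kappa> (c_odd \<kappa> a \<Lambda>))"
      using has_ant_total_derivs[OF Op[OF odd(1)]] by (simp add: D(6)[OF odd(1,2)])
    then show ?case
      by (simp add: weighted_generators(2)[OF w] KT_scale[OF d \<kappa> odd(3)] has_ant_iff_weighted)
  next
    case (even i \<Lambda>)
    have "has_ant 1 (d \<kappa> (c_even \<kappa> i \<Lambda>))"
      using has_ant_total_derivs[OF \<Delta>[OF even(1)]] by (simp add: D(7)[OF even(1,2)])
    then show ?case
      by (simp add: weighted_generators(3)[OF w] KT_scale[OF d \<kappa> even(3)] has_ant_iff_weighted)
  next
    case (add f g)
    note fg = weighted_in_Ploc[OF w add(1)] weighted_in_Ploc[OF w add(2)]
    show ?case
      unfolding weighted_add D(3)[OF fg] D(3)[OF add(1,2)] add.IH by (intro ext) simp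
  next
    case (mul f g)
    note fg = weighted_in_Ploc[OF w mul(1)] weighted_in_Ploc[OF w mul(2)]
    \<comment> \<open>In each summand of the product rule \<open>d\<close> hits exactly one factor,
      so each summand carries the factor 2 once.\<close>
    show ?case
      unfolding weighted_gmul[OF w] D(4)[OF fg] D(4)[OF mul(1,2)] mul.IH gmul_scale
        weighted_add weighted_gmul[OF w] weighted_ginv
      by (intro ext) simp
  qed
qed

text \<open>Weighting \<open>f\<close> multiplies it by \<open>2 ^ Suc k\<close>; moving the weight
  past \<open>d\<close> costs a factor 2, and cancelling it leaves the eigenvalue
  \<open>2 ^ k\<close>.\<close>

lemma has_ant_KT:
  assumes d: "is_KT_differential Y E E0 Op \<Delta> d"
    and \<kappa>: "\<kappa> \<in> acharts Y E E0"
    and Op: "\<And>a. a < vrank E \<Longrightarrow> has_ant 0 (Op \<kappa> a)"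
    and \<Delta>: "\<And>i. i < vrank E0 \<Longrightarrow> has_ant 1 (\<Delta> \<kappa> i)"
    and f: "f \<in> Ploc Y E E0 \<kappa> r" "has_ant (Suc k) f"
  shows "has_ant k (d \<kappa> f)"
proof -
  have "(\<lambda>q es ws. 2 * weighted ant_weight (d \<kappa> f) q es ws) = (\<lambda>q es ws. 2 * (2 ^ k * d \<kappa> f q es ws))"
    using weighted_KT[OF assms(1-5)] f(2) KT_scale[OF d \<kappa> f(1), of "2 ^ Suc k"]
    by (simp add: has_ant_iff_weighted mult_ac)
  then show ?thesis
    by (simp add: has_ant_iff_weighted fun_eq_iff)
qed

section \<open>Global chains of fixed antifield number\<close>

lemma P_antI:
  assumes "\<And>\<kappa>. \<kappa> \<in> acharts Y E E0 \<Longrightarrow> \<Phi> \<kappa> \<in> Ploc Y E E0 \<kappa> r"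
    and "\<And>\<kappa>. \<kappa> \<notin> acharts Y E E0 \<Longrightarrow> \<Phi> \<kappa> = 0"
    and "compatible Y E E0 \<Phi>" and "\<And>\<kappa>. has_ant k (\<Phi> \<kappa>)"
  shows "\<Phi> \<in> P_ant Y E E0 k"
  unfolding P_ant_def P_inf_def by (intro CollectI conjI exI[of _ r] ballI allI impI assms)

lemma P_antE:
  assumes "\<Phi> \<in> P_ant Y E E0 k"
  obtains r where "\<And>\<kappa>. \<kappa> \<in> acharts Y E E0 \<Longrightarrow> \<Phi> \<kappa> \<in> Ploc Y E E0 \<kappa> r"
    and "\<And>\<kappa>. \<kappa> \<notin> acharts Y E E0 \<Longrightarrow> \<Phi> \<kappa> = 0"
    and "compatible Y E E0 \<Phi>" and "\<And>\<kappa>. has_ant k (\<Phi> \<kappa>)"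
proof -
  obtain r where r: "\<forall>\<kappa>\<in>acharts Y E E0. \<Phi> \<kappa> \<in> Ploc Y E E0 \<kappa> r"
      "\<forall>\<kappa>. \<kappa> \<notin> acharts Y E E0 \<longrightarrow> \<Phi> \<kappa> = 0" "compatible Y E E0 \<Phi>" "\<forall>\<kappa>. has_ant k (\<Phi> \<kappa>)"
    using assms unfolding P_ant_def P_inf_def mem_Collect_eq
    by (elim conjE exE) (rule that; assumption)
  show ?thesis
    using r by (intro that[of r]) blast+
qed

lemma P_ant_imp_Ploc:
  "\<Phi> \<in> P_ant Y E E0 k \<Longrightarrow> \<kappa> \<in> acharts Y E E0 \<Longrightarrow> \<exists>r. \<Phi> \<kappa> \<in> Ploc Y E E0 \<kappa> r"
  by (erule P_antE) (rule exI)

lemma S_antI: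
  assumes "\<And>\<kappa>. \<kappa> \<in> acharts Y E E0 \<Longrightarrow> \<Phi> \<kappa> \<in> Sloc Y E \<kappa> r"
    and "\<And>\<kappa>. \<kappa> \<notin> acharts Y E E0 \<Longrightarrow> \<Phi> \<kappa> = 0"
    and "compatible Y E E0 \<Phi>" and "\<And>\<kappa>. has_ant k (\<Phi> \<kappa>)"
  shows "\<Phi> \<in> S_ant Y E E0 k"
  unfolding S_ant_def S_inf_def by (intro CollectI conjI exI[of _ r] ballI allI impI assms)

lemma S_antE:
  assumes "\<Phi> \<in> S_ant Y E E0 k"
  obtains r where "\<And>\<kappa>. \<kappa> \<in> acharts Y E E0 \<Longrightarrow> \<Phi> \<kappa> \<in> Sloc Y E \<kappa> r"
    and "\<And>\<kappa>. \<kappa> \<notin> acharts Y E E0 \<Longrightarrow> \<Phi> \<kappa> = 0"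
    and "compatible Y E E0 \<Phi>" and "\<And>\<kappa>. has_ant k (\<Phi> \<kappa>)"
proof -
  obtain r where r: "\<forall>\<kappa>\<in>acharts Y E E0. \<Phi> \<kappa> \<in> Sloc Y E \<kappa> r"
      "\<forall>\<kappa>. \<kappa> \<notin> acharts Y E E0 \<longrightarrow> \<Phi> \<kappa> = 0" "compatible Y E E0 \<Phi>" "\<forall>\<kappa>. has_ant k (\<Phi> \<kappa>)"
    using assms unfolding S_ant_def S_inf_def mem_Collect_eq
    by (elim conjE exE) (rule that; assumption)
  show ?thesis
    using r by (intro that[of r]) blast+
qed

lemma compatibleD:
  assumes "compatible Y E E0 \<Phi>" "\<kappa> \<in> acharts Y E E0" "\<kappa>' \<in> acharts Y E E0"
    and "covers \<kappa> x s \<and> covers \<kappa>' x s \<and> local_section Y x s \<and>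
      (\<forall>e \<in> set es. local_vsection (base Y) E x e) \<and>
      (\<forall>w \<in> set ws. local_vsection (base Y) E0 x w)"
  shows "\<Phi> \<kappa> (jet_of \<kappa> x s) (map (vjet_E E \<kappa> x) es) (map (vjet_E0 E0 \<kappa> x) ws) =
    \<Phi> \<kappa>' (jet_of \<kappa>' x s) (map (vjet_E E \<kappa>' x) es) (map (vjet_E0 E0 \<kappa>' x) ws)"
  by (rule mp[OF spec[OF spec[OF spec[OF spec[OF bspec[OF bspec[OF assms(1)[unfolded compatible_def]
    assms(2)] assms(3)]]]]] assms(4)])

lemma has_ant_iff: "has_ant k f \<longleftrightarrow> (\<forall>q es ws. length es + 2 * length ws \<noteq> k \<longrightarrow> f q es ws = 0)"
  unfolding has_ant_def by blast

lemma P_ant_zero: "0 \<in> P_ant Y E E0 k"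
proof (rule P_antI)
  show "0 \<kappa> \<in> Ploc Y E E0 \<kappa> 0" for \<kappa>
    using zero_in_Oloc[of Y \<kappa> 0] unfolding zero_fun_apply[of \<kappa>] Ploc_def
    by (intro generated.gen UnI1)
qed (simp_all add: compatible_def has_ant_def)

lemma P_ant_add:
  assumes "\<Phi> \<in> P_ant Y E E0 k" "\<Psi> \<in> P_ant Y E E0 k"
  shows "\<Phi> + \<Psi> \<in> P_ant Y E E0 k"
proof -
  obtain r where \<Phi>: "\<And>\<kappa>. \<kappa> \<in> acharts Y E E0 \<Longrightarrow> \<Phi> \<kappa> \<in> Ploc Y E E0 \<kappa> r"
      "\<And>\<kappa>. \<kappa> \<notin> acharts Y E E0 \<Longrightarrow> \<Phi> \<kappa> = 0" "compatible Y E E0 \<Phi>" "\<And>\<kappa>. has_ant k (\<Phi> \<kappa>)"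
    using P_antE[OF assms(1)] by blast
  obtain r' where \<Psi>: "\<And>\<kappa>. \<kappa> \<in> acharts Y E E0 \<Longrightarrow> \<Psi> \<kappa> \<in> Ploc Y E E0 \<kappa> r'"
      "\<And>\<kappa>. \<kappa> \<notin> acharts Y E E0 \<Longrightarrow> \<Psi> \<kappa> = 0" "compatible Y E E0 \<Psi>" "\<And>\<kappa>. has_ant k (\<Psi> \<kappa>)"
    using P_antE[OF assms(2)] by blast
  show ?thesis
  proof (rule P_antI)
    fix \<kappa> assume \<kappa>: "\<kappa> \<in> acharts Y E E0"
    \<comment> \<open>The jet orders of the two chains may differ; their maximum is a bound for
      both, uniformly over the charts.\<close>
    have "\<Phi> \<kappa> \<in> Ploc Y E E0 \<kappa> (max r r')" "\<Psi> \<kappa> \<in> Ploc Y E E0 \<kappa> (max r r')"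
      by (rule subsetD[OF Ploc_mono \<Phi>(1)[OF \<kappa>]] subsetD[OF Ploc_mono \<Psi>(1)[OF \<kappa>]], simp)+
    then show "(\<Phi> + \<Psi>) \<kappa> \<in> Ploc Y E E0 \<kappa> (max r r')"
      unfolding Ploc_def plus_fun_def[of \<Phi>] by (rule generated.add)
  next
    show "compatible Y E E0 (\<Phi> + \<Psi>)"
      unfolding compatible_def plus_fun_apply
      by (intro ballI allI impI arg_cong2[where f = "(+)"] compatibleD[OF \<Phi>(3)] compatibleD[OF \<Psi>(3)])
  next
    show "has_ant k ((\<Phi> + \<Psi>) \<kappa>)" for \<kappa>
      using \<Phi>(4)[of \<kappa>] \<Psi>(4)[of \<kappa>] unfolding has_ant_iff by simp
  qed (simp add: \<Phi>(2) \<Psi>(2))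
qed

lemma P_ant_uminus:
  assumes "\<Phi> \<in> P_ant Y E E0 k"
  shows "- \<Phi> \<in> P_ant Y E E0 k"
proof -
  obtain r where \<Phi>: "\<And>\<kappa>. \<kappa> \<in> acharts Y E E0 \<Longrightarrow> \<Phi> \<kappa> \<in> Ploc Y E E0 \<kappa> r"
      "\<And>\<kappa>. \<kappa> \<notin> acharts Y E E0 \<Longrightarrow> \<Phi> \<kappa> = 0" "compatible Y E E0 \<Phi>" "\<And>\<kappa>. has_ant k (\<Phi> \<kappa>)"
    using P_antE[OF assms] by blast
  show ?thesis
  proof (rule P_antI)
    fix \<kappa> assume "\<kappa> \<in> acharts Y E E0"
    \<comment> \<open>Negatives are not built into \<open>generated\<close>, so they are obtained as
      multiples by the constant -1.\<close>
    from Ploc_scale[OF \<Phi>(1)[OF this], of "- 1"]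
    show "(- \<Phi>) \<kappa> \<in> Ploc Y E E0 \<kappa> r"
      by (simp add: fun_Compl_def)
  next
    show "compatible Y E E0 (- \<Phi>)"
      unfolding compatible_def uminus_apply
      by (intro ballI allI impI arg_cong[where f = uminus] compatibleD[OF \<Phi>(3)])
  next
    show "has_ant k ((- \<Phi>) \<kappa>)" for \<kappa>
      using \<Phi>(4)[of \<kappa>] unfolding has_ant_iff by simp
  qed (simp add: \<Phi>(2))
qed

lemma P_ant_G_part:
  assumes "\<Phi> \<in> P_ant Y E E0 k"
  shows "G_part \<Phi> \<in> P_ant Y E E0 k"
proof -
  obtain r where \<Phi>: "\<And>\<kappa>. \<kappa> \<in> acharts Y E E0 \<Longrightarrow> \<Phi> \<kappa> \<in> Ploc Y E E0 \<kappa> r"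
      "\<And>\<kappa>. \<kappa> \<notin> acharts Y E E0 \<Longrightarrow> \<Phi> \<kappa> = 0" "compatible Y E E0 \<Phi>" "\<And>\<kappa>. has_ant k (\<Phi> \<kappa>)"
    using P_antE[OF assms] by blast
  \<comment> \<open>Extracting the summand means setting the odd generators to zero, which preserves
    the local algebras.\<close>
  have G: "G_part \<Phi> \<kappa> = weighted (\<lambda>a b. if a = 0 then 1 else 0) (\<Phi> \<kappa>)" for \<kappa>
    by (simp add: G_part_def weighted_def fun_eq_iff)
  show ?thesis
  proof (rule P_antI)
    show "G_part \<Phi> \<kappa> \<in> Ploc Y E E0 \<kappa> r" if "\<kappa> \<in> acharts Y E E0" for \<kappa>
      unfolding G by (rule weighted_in_Ploc[OF multiplicative_weights(2) \<Phi>(1)[OF that]])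
    show "compatible Y E E0 (G_part \<Phi>)"
      unfolding compatible_def G_part_def map_is_Nil_conv
      by (intro ballI allI impI if_cong[OF refl _ refl] compatibleD[OF \<Phi>(3)])
    show "has_ant k (G_part \<Phi> \<kappa>)" for \<kappa>
      using \<Phi>(4)[of \<kappa>] unfolding has_ant_iff by (simp add: G_part_def)
    show "G_part \<Phi> \<kappa> = 0" if "\<kappa> \<notin> acharts Y E E0" for \<kappa>
      using \<Phi>(2)[OF that] by (simp add: G_part_def fun_eq_iff)
  qed
qed

lemma S_ant_imp_P_ant:
  assumes "\<Phi> \<in> S_ant Y E E0 k"
  shows "\<Phi> \<in> P_ant Y E E0 k"
proof -
  obtain r where \<Phi>: "\<And>\<kappa>. \<kappa> \<in> acharts Y E E0 \<Longrightarrow> \<Phi> \<kappa> \<in> Sloc Y E \<kappa> r"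
      "\<And>\<kappa>. \<kappa> \<notin> acharts Y E E0 \<Longrightarrow> \<Phi> \<kappa> = 0" "compatible Y E E0 \<Phi>" "\<And>\<kappa>. has_ant k (\<Phi> \<kappa>)"
    using S_antE[OF assms] by blast
  then show ?thesis
    by (intro P_antI[of Y E E0 \<Phi> r] subsetD[OF Sloc_subset_Ploc])
qed

text \<open>Without odd arguments, an empty list of even arguments contradicts antifield number 2,
  and a nonempty one is excluded because no even generators occur.\<close>

lemma G_part_S_ant:
  assumes "\<Phi> \<in> S_ant Y E E0 2"
  shows "G_part \<Phi> = 0"
proof -
  obtain r where \<Phi>: "\<And>\<kappa>. \<kappa> \<in> acharts Y E E0 \<Longrightarrow> \<Phi> \<kappa> \<in> Sloc Y E \<kappa> r"
      "\<And>\<kappa>. \<kappa> \<notin> acharts Y E E0 \<Longrightarrow> \<Phi> \<kappa> = 0" "compatible Y E E0 \<Phi>" "\<And>\<kappa>. has_ant 2 (\<Phi> \<kappa>)"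
    using S_antE[OF assms] by blast
  have "\<Phi> \<kappa> q [] ws = 0" for \<kappa> q ws
  proof (cases "ws = []")
    case True
    then show ?thesis
      using \<Phi>(4)[of \<kappa>] by (simp add: has_ant_iff)
  next
    case False
    then show ?thesis
      using Sloc_no_even[OF \<Phi>(1)[of \<kappa>]] \<Phi>(2)[of \<kappa>] by (cases "\<kappa> \<in> acharts Y E E0") simp_all
  qed
  then show ?thesis
    by (intro ext) (simp add: G_part_def)
qed

text \<open>One even argument already exhausts antifield number 2, so a component with even
  arguments has no odd ones and belongs to the vanishing summand. Hence only odd generators
  occur.\<close>

lemma S_ant_of_G_part_zero:
  assumes "\<Phi> \<in> P_ant Y E E0 2" "G_part \<Phi> = 0"
  shows "\<Phi> \<in> S_ant Y E E0 2"
proof -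
  obtain r where \<Phi>: "\<And>\<kappa>. \<kappa> \<in> acharts Y E E0 \<Longrightarrow> \<Phi> \<kappa> \<in> Ploc Y E E0 \<kappa> r"
      "\<And>\<kappa>. \<kappa> \<notin> acharts Y E E0 \<Longrightarrow> \<Phi> \<kappa> = 0" "compatible Y E E0 \<Phi>" "\<And>\<kappa>. has_ant 2 (\<Phi> \<kappa>)"
    using P_antE[OF assms(1)] by blast
  have "\<Phi> \<kappa> q es ws = 0" if "ws \<noteq> []" for \<kappa> q es ws
  proof (cases "es = []")
    case True
    then show ?thesis
      using fun_cong[OF fun_cong[OF fun_cong[OF fun_cong[OF assms(2)]]], of \<kappa> q es ws]
      by (simp add: G_part_def)
  next
    case False
    with that have "length es + 2 * length ws \<noteq> 2"
      by (cases es; cases ws) auto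
    then show ?thesis
      using \<Phi>(4)[of \<kappa>] unfolding has_ant_iff by blast
  qed
  then show ?thesis
    using Ploc_no_even_in_Sloc[OF \<Phi>(1)] by (intro S_antI[of Y E E0 \<Phi> r] \<Phi>(2-4)) blast
qed

section \<open>The differentials on global chains\<close>

lemma act_add:
  assumes d: "is_KT_differential Y E E0 Op \<Delta> d"
    and \<Phi>: "\<Phi> \<in> P_ant Y E E0 k" and \<Psi>: "\<Psi> \<in> P_ant Y E E0 k"
  shows "act Y E E0 d (\<Phi> + \<Psi>) = act Y E E0 d \<Phi> + act Y E E0 d \<Psi>"
proof (rule ext)
  fix \<kappa>
  show "act Y E E0 d (\<Phi> + \<Psi>) \<kappa> = (act Y E E0 d \<Phi> + act Y E E0 d \<Psi>) \<kappa>"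
  proof (cases "\<kappa> \<in> acharts Y E E0")
    case True
    then obtain r r' where "\<Phi> \<kappa> \<in> Ploc Y E E0 \<kappa> r" "\<Psi> \<kappa> \<in> Ploc Y E E0 \<kappa> r'"
      using P_ant_imp_Ploc[OF \<Phi>] P_ant_imp_Ploc[OF \<Psi>] by blast
    from KT_differentialD(3)[OF d True this] True show ?thesis
      by (simp only: act_def plus_fun_apply if_True)
  qed (simp add: act_def)
qed

lemma act_zero:
  assumes d: "is_KT_differential Y E E0 Op \<Delta> d"
  shows "act Y E E0 d 0 = 0"
  by (rule ext) (simp add: act_def KT_differentialD(5)[OF d _ zero_in_Oloc])

lemma act_uminus:
  assumes d: "is_KT_differential Y E E0 Op \<Delta> d" and \<Phi>: "\<Phi> \<in> P_ant Y E E0 k"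
  shows "act Y E E0 d (- \<Phi>) = - act Y E E0 d \<Phi>"
proof -
  have "act Y E E0 d \<Phi> + act Y E E0 d (- \<Phi>) = 0"
    unfolding act_add[OF d \<Phi> P_ant_uminus[OF \<Phi>], symmetric] right_minus by (rule act_zero[OF d])
  then show ?thesis
    by (rule minus_unique[symmetric])
qed

lemma act_act:
  assumes d: "is_KT_differential Y E E0 Op \<Delta> d" and \<Phi>: "\<Phi> \<in> P_ant Y E E0 k"
  shows "act Y E E0 d (act Y E E0 d \<Phi>) = 0"
proof (rule ext)
  fix \<kappa>
  show "act Y E E0 d (act Y E E0 d \<Phi>) \<kappa> = 0 \<kappa>"
  proof (cases "\<kappa> \<in> acharts Y E E0")
    case True
    then obtain r where "\<Phi> \<kappa> \<in> Ploc Y E E0 \<kappa> r"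
      using P_ant_imp_Ploc[OF \<Phi>] by blast
    with True show ?thesis
      by (simp add: act_def KT_differentialD(2)[OF d True])
  qed (simp add: act_def)
qed

text \<open>The antifield number is computed chart by chart, while the uniform jet order and the
  compatibility between charts come from the requirement that the differential preserves
  \<open>P_inf\<close>.\<close>

lemma act_P_ant:
  assumes d: "is_KT_differential Y E E0 Op \<Delta> d"
    and Op: "\<And>\<kappa> a. \<kappa> \<in> acharts Y E E0 \<Longrightarrow> a < vrank E \<Longrightarrow> has_ant 0 (Op \<kappa> a)"
    and \<Delta>: "\<And>\<kappa> i. \<kappa> \<in> acharts Y E E0 \<Longrightarrow> i < vrank E0 \<Longrightarrow> has_ant 1 (\<Delta> \<kappa> i)"
    and \<Phi>: "\<Phi> \<in> P_ant Y E E0 (Suc k)"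
  shows "act Y E E0 d \<Phi> \<in> P_ant Y E E0 k"
proof -
  have "has_ant k (act Y E E0 d \<Phi> \<kappa>)" for \<kappa>
  proof (cases "\<kappa> \<in> acharts Y E E0")
    case True
    then obtain r where "\<Phi> \<kappa> \<in> Ploc Y E E0 \<kappa> r" "has_ant (Suc k) (\<Phi> \<kappa>)"
      using P_ant_imp_Ploc[OF \<Phi>] \<Phi> unfolding P_ant_def by blast
    then show ?thesis
      using has_ant_KT[OF d True Op[OF True] \<Delta>[OF True]] True by (simp add: act_def)
  qed (simp add: act_def has_ant_def)
  moreover have "act Y E E0 d \<Phi> \<in> P_inf Y E E0"
  proof -
    have "\<Phi> \<in> P_inf Y E E0"
      using \<Phi> unfolding P_ant_def by simp
    then show ?thesis
      by (rule bspec[OF conjunct2[OF d[unfolded is_KT_differential_def]]])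
  qed
  ultimately show ?thesis
    unfolding P_ant_def by blast
qed

section \<open>Boundaries and classes in the second homology\<close>

lemma two_boundaries_add:
  assumes d: "is_KT_differential Y E E0 Op \<Delta> d"
    and "\<Phi> \<in> two_boundaries Y E E0 d" "\<Psi> \<in> two_boundaries Y E E0 d"
  shows "\<Phi> + \<Psi> \<in> two_boundaries Y E E0 d"
proof -
  obtain A B where A: "A \<in> P_ant Y E E0 3" "\<Phi> = act Y E E0 d A"
    and B: "B \<in> P_ant Y E E0 3" "\<Psi> = act Y E E0 d B"
    using assms(2,3) unfolding two_boundaries_def by blast
  show ?thesis
    unfolding two_boundaries_def A(2) B(2) act_add[OF d A(1) B(1), symmetric]
    by (rule imageI[OF P_ant_add[OF A(1) B(1)]])
qed

lemma two_boundaries_uminus: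
  assumes d: "is_KT_differential Y E E0 Op \<Delta> d" and "\<Phi> \<in> two_boundaries Y E E0 d"
  shows "- \<Phi> \<in> two_boundaries Y E E0 d"
proof -
  obtain A where A: "A \<in> P_ant Y E E0 3" "\<Phi> = act Y E E0 d A"
    using assms(2) unfolding two_boundaries_def by blast
  show ?thesis
    unfolding two_boundaries_def A(2) act_uminus[OF d A(1), symmetric]
    by (rule imageI[OF P_ant_uminus[OF A(1)]])
qed

lemma two_boundaries_zero:
  assumes d: "is_KT_differential Y E E0 Op \<Delta> d"
  shows "0 \<in> two_boundaries Y E E0 d"
  unfolding two_boundaries_def using imageI[OF P_ant_zero, of "act Y E E0 d"] act_zero[OF d] by simp

text \<open>The classes are cosets of the subgroup of boundaries, and each coset contains its
  representative because 0 is a boundary.\<close>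

lemma H2_class_eq_zero_iff:
  assumes d: "is_KT_differential Y E E0 Op \<Delta> d"
  shows "H2_class Y E E0 d \<Phi> = H2_class Y E E0 d 0 \<longleftrightarrow> \<Phi> \<in> two_boundaries Y E E0 d"
proof -
  let ?B = "two_boundaries Y E E0 d"
  have zero: "H2_class Y E E0 d 0 = ?B"
    unfolding H2_class_def by (auto simp only: add_0)
  have mem: "\<Phi> \<in> H2_class Y E E0 d \<Phi>"
    unfolding H2_class_def
    by (intro CollectI exI[of _ 0] conjI) (simp_all only: add_0_right two_boundaries_zero[OF d])
  have "H2_class Y E E0 d \<Phi> = ?B" if \<Phi>: "\<Phi> \<in> ?B"
  proof (intro equalityI subsetI)
    show "\<Psi> \<in> ?B" if "\<Psi> \<in> H2_class Y E E0 d \<Phi>" for \<Psi>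
      using that two_boundaries_add[OF d \<Phi>] unfolding H2_class_def by (auto simp only:)
    show "\<Psi> \<in> H2_class Y E E0 d \<Phi>" if "\<Psi> \<in> ?B" for \<Psi>
      unfolding H2_class_def
    proof (intro CollectI exI conjI)
      show "\<Psi> = \<Phi> + (- \<Phi> + \<Psi>)"
        by (simp only: add.assoc[symmetric] right_minus add_0)
      show "- \<Phi> + \<Psi> \<in> ?B"
        by (rule two_boundaries_add[OF d two_boundaries_uminus[OF d \<Phi>] that])
    qed
  qed
  with zero mem show ?thesis by metis
qed

text \<open>Both sides of the identification exclude boundaries, so they can disagree only at a
  cycle that is not a boundary and whose summand satisfies \<open>V\<close>.\<close>

lemma identities_are_H2_iff:
  assumes "is_KT_differential Y E E0 Op \<Delta> d"
  shows "identities_are_H2 Y E E0 d V \<longleftrightarrow>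
    (\<forall>\<Phi> \<in> two_cycles Y E E0 d. V (G_part \<Phi>) \<longrightarrow> \<Phi> \<in> two_boundaries Y E E0 d)"
  unfolding identities_are_H2_def first_stage_noether_identity_def H2_class_eq_zero_iff[OF assms]
  by blast

section \<open>The criterion for an arbitrary sense of vanishing\<close>

text \<open>Keeping \<open>V\<close> abstract treats both senses of vanishing on the kernel at once.
  One direction needs that 0 vanishes, the other that vanishing implies \<delta>-exactness for
  chains equal to their own summand \<open>G\<close>.\<close>

lemma identities_are_H2_iff_delta_cycles_bound:
  assumes Op: "is_diff_operator Y E E0 Op"
    and d: "is_KT_differential Y E E0 Op (\<lambda>\<kappa> i. 0) \<delta>"
    and \<Delta>: "\<And>\<kappa> i. \<kappa> \<in> acharts Y E E0 \<Longrightarrow> i < vrank E0 \<Longrightarrow> has_ant 1 (\<Delta> \<kappa> i)"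
    and d0: "is_KT_differential Y E E0 Op \<Delta> \<delta>0"
    and V0: "V 0"
    and V: "\<And>G. G \<in> P_ant Y E E0 2 \<Longrightarrow> G_part G = G \<Longrightarrow> V G \<Longrightarrow> vanishes_mod_delta Y E E0 \<delta> G"
  shows "identities_are_H2 Y E E0 \<delta>0 V \<longleftrightarrow>
    (\<forall>\<Phi> \<in> S_ant Y E E0 2. act Y E E0 \<delta> \<Phi> = 0 \<longrightarrow> \<Phi> \<in> two_boundaries Y E E0 \<delta>0)"
proof -
  have Op0: "has_ant 0 (Op \<kappa> a)" if \<kappa>: "\<kappa> \<in> acharts Y E E0" and a: "a < vrank E" for \<kappa> a
  proof -
    obtain r where "Op \<kappa> a \<in> Oloc Y \<kappa> r"
      using Op \<kappa> a unfolding is_diff_operator_def by blast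
    then obtain F where
      "Op \<kappa> a = (\<lambda>q es ws. if q \<in> jdom \<kappa> \<and> es = [] \<and> ws = [] then F (restr (jvars Y r) q) else 0)"
      unfolding Oloc_def by blast
    then show ?thesis
      by (simp add: has_ant_def)
  qed
  have act_S: "act Y E E0 \<delta> \<Phi> = act Y E E0 \<delta>0 \<Phi>" if S: "\<Phi> \<in> S_ant Y E E0 2" for \<Phi>
  proof -
    obtain r where \<Phi>: "\<forall>\<kappa>\<in>acharts Y E E0. \<Phi> \<kappa> \<in> Sloc Y E \<kappa> r"
      using S unfolding S_ant_def S_inf_def mem_Collect_eq by (elim conjE exE) (rule that; assumption)
    show ?thesis
      unfolding act_def by (rule ext, rule if_cong[OF refl _ refl]) (rule KT_differentials_agree_on_Sloc[OF d d0 _ bspec[OF \<Phi>]])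
  qed
  have G_act: "G_part (act Y E E0 \<delta> \<Psi>) = G_part (act Y E E0 \<delta>0 \<Psi>)" if \<Psi>: "\<Psi> \<in> P_ant Y E E0 3" for \<Psi>
  proof -
    have "\<delta> \<kappa> (\<Psi> \<kappa>) q [] ws = \<delta>0 \<kappa> (\<Psi> \<kappa>) q [] ws" if \<kappa>: "\<kappa> \<in> acharts Y E E0" for \<kappa> q ws
    proof -
      obtain r where "\<Psi> \<kappa> \<in> Ploc Y E E0 \<kappa> r"
        using P_ant_imp_Ploc[OF \<Psi> \<kappa>] by blast
      then show ?thesis
        \<comment> \<open>For \<delta> the role of the Noether operators is played by 0, which has
          every antifield number.\<close>
        by (rule KT_differentials_agree_without_odd[OF d d0 \<kappa> _ \<Delta>[OF \<kappa>], rotated -1])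
          (simp_all add: has_ant_def)
    qed
    then show ?thesis
      by (auto simp: G_part_def act_def fun_eq_iff)
  qed
  have "\<Phi> \<in> two_boundaries Y E E0 \<delta>0"
    if bound: "\<forall>\<Phi> \<in> S_ant Y E E0 2. act Y E E0 \<delta> \<Phi> = 0 \<longrightarrow> \<Phi> \<in> two_boundaries Y E E0 \<delta>0"
      and \<Phi>: "\<Phi> \<in> two_cycles Y E E0 \<delta>0" and VG: "V (G_part \<Phi>)" for \<Phi>
  proof -
    have \<Phi>P: "\<Phi> \<in> P_ant Y E E0 2" and cyc: "act Y E E0 \<delta>0 \<Phi> = 0"
      using \<Phi> by (auto simp: two_cycles_def)
    have GG: "G_part (G_part \<Phi>) = G_part \<Phi>"
      by (simp add: G_part_def fun_eq_iff)
    then obtain \<Psi> where \<Psi>: "\<Psi> \<in> P_ant Y E E0 3" and G: "G_part \<Phi> = act Y E E0 \<delta> \<Psi>"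
      using V[OF P_ant_G_part[OF \<Phi>P] _ VG] unfolding vanishes_mod_delta_def by auto
    \<comment> \<open>The correcting boundary applies the extended differential to the same \<Psi>
      that makes \<open>G\<close> exact for \<delta>. By \<open>G_act\<close> it has the summand
      \<open>G\<close>, so subtracting it leaves odd generators only.\<close>
    let ?B = "act Y E E0 \<delta>0 \<Psi>"
    have B: "?B \<in> P_ant Y E E0 2"
      by (rule act_P_ant[OF d0 Op0 \<Delta>]) (use \<Psi> in \<open>simp_all add: numeral_3_eq_3\<close>)
    have "\<Phi> + - ?B \<in> P_ant Y E E0 2"
      by (rule P_ant_add[OF \<Phi>P P_ant_uminus[OF B]])
    moreover have "G_part (\<Phi> + - ?B) = 0"
    proof -
      have "G_part (\<Phi> + - ?B) = G_part \<Phi> + - G_part ?B"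
        by (intro ext) (simp add: G_part_def)
      also have "G_part ?B = G_part \<Phi>"
        using G_act[OF \<Psi>] G GG by simp
      finally show ?thesis
        by (simp only: right_minus)
    qed
    ultimately have S: "\<Phi> + - ?B \<in> S_ant Y E E0 2"
      by (rule S_ant_of_G_part_zero)
    moreover have "act Y E E0 \<delta>0 (\<Phi> + - ?B) = 0"
      by (simp add: act_add[OF d0 \<Phi>P P_ant_uminus[OF B]] act_uminus[OF d0 B] act_act[OF d0 \<Psi>] cyc
          del: add_uminus_conv_diff)
    ultimately have "\<Phi> + - ?B \<in> two_boundaries Y E E0 \<delta>0"
      using bound act_S by metis
    moreover have "?B \<in> two_boundaries Y E E0 \<delta>0"
      using \<Psi> by (simp add: two_boundaries_def)
    ultimately have "(\<Phi> + - ?B) + ?B \<in> two_boundaries Y E E0 \<delta>0"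
      by (rule two_boundaries_add[OF d0])
    then show ?thesis by simp
  qed
  \<comment> \<open>For the other direction: a \<delta>-cycle in the odd generators is a cycle of
    the extended differential with summand 0, so \<open>V0\<close> makes it an instance of the
    identification criterion.\<close>
  moreover have "\<Phi> \<in> two_cycles Y E E0 \<delta>0 \<and> V (G_part \<Phi>)"
    if "\<Phi> \<in> S_ant Y E E0 2" "act Y E E0 \<delta> \<Phi> = 0" for \<Phi>
    using that act_S[OF that(1)] S_ant_imp_P_ant[OF that(1)] G_part_S_ant[OF that(1)] V0
    by (auto simp: two_cycles_def)
  ultimately show ?thesis
    unfolding identities_are_H2_iff[OF d0] by blast
qed

theorem proposition6:
  fixes Y :: "('x::{t2_space,second_countable_topology}, 'y, 'v::{t2_space,second_countable_topology}) fbundle"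
    and E :: "('x, 'f::real_vector) vbundle"
    and E0 :: "('x, 'g::real_vector) vbundle"
    and Op \<Delta> :: "('x, 'y, 'v, 'f, 'g) achart \<Rightarrow> nat \<Rightarrow> gfun"
    and \<delta> \<delta>0 :: "('x, 'y, 'v, 'f, 'g) achart \<Rightarrow> gfun \<Rightarrow> gfun"
  assumes "is_fibre_bundle Y"
    and "is_vector_bundle (base Y) E"
    and "is_vector_bundle (base Y) E0"
    and "is_diff_operator Y E E0 Op"
    and "is_KT_differential Y E E0 Op (\<lambda>\<kappa> i. 0) \<delta>"
    and "generates_H1 Y E E0 \<delta> \<Delta>"
    and "is_KT_differential Y E E0 Op \<Delta> \<delta>0"
  shows "(identities_are_H2 Y E E0 \<delta>0 (vanishes_mod_delta Y E E0 \<delta>) \<longleftrightarrow>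
            (\<forall>\<Phi> \<in> S_ant Y E E0 2. act Y E E0 \<delta> \<Phi> = 0 \<longrightarrow> \<Phi> \<in> two_boundaries Y E E0 \<delta>0)) \<and>
         (regular_operator Y E E0 Op \<delta> \<longrightarrow>
           (identities_are_H2 Y E E0 \<delta>0 (vanishes_on_Ker Y E E0 Op) \<longleftrightarrow>
              (\<forall>\<Phi> \<in> S_ant Y E E0 2. act Y E E0 \<delta> \<Phi> = 0 \<longrightarrow> \<Phi> \<in> two_boundaries Y E E0 \<delta>0)))"
proof (intro conjI impI)
  have \<Delta>: "has_ant 1 (\<Delta> \<kappa> i)" if "\<kappa> \<in> acharts Y E E0" "i < vrank E0" for \<kappa> i
    using assms(6) that unfolding generates_H1_def by blast
  note iff = identities_are_H2_iff_delta_cycles_bound[OF assms(4,5) \<Delta> assms(7)]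
  show "identities_are_H2 Y E E0 \<delta>0 (vanishes_mod_delta Y E E0 \<delta>) \<longleftrightarrow>
      (\<forall>\<Phi> \<in> S_ant Y E E0 2. act Y E E0 \<delta> \<Phi> = 0 \<longrightarrow> \<Phi> \<in> two_boundaries Y E E0 \<delta>0)"
    \<comment> \<open>In this sense vanishing is exactness itself, and 0 is the image of 0.\<close>
    by (rule iff) (use two_boundaries_zero[OF assms(5)] in
      \<open>auto simp: vanishes_mod_delta_def two_boundaries_def\<close>)
  assume reg: "regular_operator Y E E0 Op \<delta>"
  show "identities_are_H2 Y E E0 \<delta>0 (vanishes_on_Ker Y E E0 Op) \<longleftrightarrow>
      (\<forall>\<Phi> \<in> S_ant Y E E0 2. act Y E E0 \<delta> \<Phi> = 0 \<longrightarrow> \<Phi> \<in> two_boundaries Y E E0 \<delta>0)"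
    \<comment> \<open>Regularity is exactly the passage from pointwise vanishing to
      \<delta>-exactness.\<close>
    by (rule iff) (use reg in \<open>auto simp: regular_operator_def vanishes_on_Ker_def\<close>)
qed

end
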